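(* Fix $a,b>0$ and choose $\psi\in L^2([0,b))$. The set $\{\varphi\,\sharp\,\psi:\varphi\in L^2([0,a))\}$ is gap-rich in $L^2([0,a+b))$.
   Context: All $L^2$ spaces consist of real-valued functions. For $\varphi\in L^2([0,a))$ and $\psi\in L^2([0,b))$, the concatenation $\varphi\,\sharp\,\psi\in L^2([0,a+b))$ equals $\varphi(x)$ for $x\in[0,a)$ and $\psi(x-a)$ for $x\in[a,a+b)$. Let $c>0$ and let $Y\subseteq L^2([0,c))$ be perfect (closed without isolated points), with metric $d$ induced by the $L^2$ norm. Words over $Y$: $Y^\star=\bigcup_{p\ge1}Y^p$. For $\boldsymbol{x}\in Y^p$, $\boldsymbol{x}^{\sharp\mathbb{Z}}\in Y^{\mathbb{Z}}$ is the $p$-periodic sequence coinciding with $\boldsymbol{x}$ on $\{1,\ldots,p\}$. For words $\boldsymbol{x},\boldsymbol{y}\in Y^\star$ of possibly different lengths, $d(\boldsymbol{x},\boldsymbol{y}):=\sup_{j\in\mathbb{Z}}d\big((\boldsymbol{x}^{\sharp\mathbb{Z}})_j,(\boldsymbol{y}^{\sharp\mathbb{Z}})_j\big)$. For a periodic sequence $\boldsymbol{y}=(y_j)_{j\in\mathbb{Z}}\in Y^{\mathbb{Z}}$, $\boldsymbol{y}^\natural:\mathbb{R}\to\mathbb{R}$ is given by $\boldsymbol{y}^\natural(x)=y_j(x-jc)$ for $x\in[jc,(j+1)c)$, $j\in\mathbb{Z}$, and $L_{\boldsymbol{y}}=-\partial_x^2+\boldsymbol{y}^\natural$ is the associated self-adjoint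 Schr\"odinger operator in $L^2(\mathbb{R})$. For a word $\boldsymbol{x}\in Y^\star$, $L_{\boldsymbol{x}}:=L_{\boldsymbol{x}^{\sharp\mathbb{Z}}}$. $\operatorname{spec}$ denotes the spectrum. $Y$ is gap-rich with exceptional set $S\subseteq\mathbb{R}$ if $S$ is discrete and for every $E\in\mathbb{R}\setminus S$, $\boldsymbol{x}\in Y^\star$ and $\varepsilon>0$ there exists $\boldsymbol{y}\in Y^\star$ with $d(\boldsymbol{x},\boldsymbol{y})<\varepsilon$ and $E\notin\operatorname{spec}(L_{\boldsymbol{y}})$. $Y$ is gap-rich if it is gap-rich with some exceptional set. *)

theory Defs
  imports "HOL-Analysis.Analysis"
begin

section \<open>The real Hilbert space of square-integrable functions on the line\<close>

definition square_integrable :: "(real \<Rightarrow> real) \<Rightarrow> bool" where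
  "square_integrable f \<longleftrightarrow> f \<in> borel_measurable borel \<and> integrable lborel (\<lambda>x. (f x)\<^sup>2)"

lemma square_integrable_zero [simp]: "square_integrable (\<lambda>_. 0)"
  by (simp add: square_integrable_def)

lemma square_integrable_mult:
  assumes "square_integrable f" "square_integrable g"
  shows "integrable lborel (\<lambda>x. f x * g x)"
proof (rule Bochner_Integration.integrable_bound)
  show "integrable lborel (\<lambda>x. (f x)\<^sup>2 + (g x)\<^sup>2)"
    using assms by (auto simp: square_integrable_def)
  show "(\<lambda>x. f x * g x) \<in> borel_measurable lborel"
    using assms by (auto simp: square_integrable_def)
  have "\<bar>s * t\<bar> \<le> s\<^sup>2 + t\<^sup>2" for s t :: real
  proof -
    have "2 * (\<bar>s\<bar> * \<bar>t\<bar>) \<le> s\<^sup>2 + t\<^sup>2"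
      using sum_squares_bound[of "\<bar>s\<bar>" "\<bar>t\<bar>"] by simp
    moreover have "0 \<le> \<bar>s\<bar> * \<bar>t\<bar>" by simp
    ultimately have "\<bar>s\<bar> * \<bar>t\<bar> \<le> s\<^sup>2 + t\<^sup>2" by linarith
    then show ?thesis by (simp add: abs_mult)
  qed
  then show "AE x in lborel. norm (f x * g x) \<le> norm ((f x)\<^sup>2 + (g x)\<^sup>2)"
    by (auto simp: abs_of_nonneg)
qed

lemma square_integrable_add:
  assumes "square_integrable f" "square_integrable g"
  shows "square_integrable (\<lambda>x. f x + g x)"
proof -
  have "integrable lborel (\<lambda>x. (f x)\<^sup>2 + (g x)\<^sup>2 + 2 * (f x * g x))"
    using assms square_integrable_mult[OF assms] by (auto simp: square_integrable_def)
  then show ?thesis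
    using assms by (auto simp: square_integrable_def power2_sum mult.assoc)
qed

lemma square_integrable_cmult:
  assumes "square_integrable f"
  shows "square_integrable (\<lambda>x. r * f x)"
  using assms by (auto simp: square_integrable_def power_mult_distrib)

lemma square_integrable_shift:
  assumes "square_integrable f"
  shows "square_integrable (\<lambda>x. f (x - t))"
proof -
  have "integrable lborel (\<lambda>x. (f (- t + 1 * x))\<^sup>2)"
    using assms by (intro lborel_integrable_real_affine) (auto simp: square_integrable_def)
  then show ?thesis
    using assms by (auto simp: square_integrable_def)
qed

lemma square_integrable_restrict:
  assumes "square_integrable f" "A \<in> sets borel"
  shows "square_integrable (\<lambda>x. if x \<in> A then f x else 0)"
proof -
  have "integrable lborel (\<lambda>x. (if x \<in> A then f x else 0)\<^sup>2)"
    by (rule Bochner_Integration.integrable_bound[of lborel "\<lambda>x. (f x)\<^sup>2"])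
      (use assms in \<open>auto simp: square_integrable_def\<close>)
  then show ?thesis
    using assms by (auto simp: square_integrable_def)
qed

lemma AE_lborel_shift:
  fixes t :: real
  assumes "AE x in lborel. P x"
  shows "AE x in lborel. P (x - t)"
proof -
  have "(AE x in distr lborel borel ((+) (- t)). P x) \<longleftrightarrow> (AE x in lborel. P x)"
    by (simp only: lborel_distr_plus)
  with assms have "AE x in distr lborel borel ((+) (- t)). P x" by simp
  then have "AE x in lborel. P (- t + x)"
    by (rule AE_distrD[rotated]) simp
  then show ?thesis by simp
qed

quotient_type l2 = "real \<Rightarrow> real" / partial:
  "\<lambda>f g. square_integrable f \<and> square_integrable g \<and> (AE x in lborel. f x = g x)"
  morphisms rep_l2 Abs_l2
  by (rule part_equivpI) (auto intro!: exI[of _ "\<lambda>_. 0"] sympI transpI)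

text \<open>A representative of an element of \<open>l2\<close>, determined up to null sets.\<close>

definition l2_fun :: "l2 \<Rightarrow> real \<Rightarrow> real" where
  "l2_fun u = (SOME f. square_integrable f \<and> Abs_l2 f = u)"

lemma l2_fun: "square_integrable (l2_fun u)" "Abs_l2 (l2_fun u) = u"
proof -
  have "\<exists>f. square_integrable f \<and> Abs_l2 f = u"
    using Quotient3_l2 by (induct u rule: l2.abs_induct) auto
  from someI_ex[OF this] show "square_integrable (l2_fun u)" "Abs_l2 (l2_fun u) = u"
    by (auto simp: l2_fun_def)
qed

lemma Abs_l2_eq_iff:
  assumes "square_integrable f" "square_integrable g"
  shows "Abs_l2 f = Abs_l2 g \<longleftrightarrow> (AE x in lborel. f x = g x)"
  using assms Quotient3_rel[OF Quotient3_l2, of f g] by auto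

lemma l2_fun_Abs:
  assumes "square_integrable f"
  shows "AE x in lborel. l2_fun (Abs_l2 f) x = f x"
  using Abs_l2_eq_iff[OF l2_fun(1) assms] l2_fun(2) by blast

instantiation l2 :: real_inner
begin

lift_definition zero_l2 :: l2 is "\<lambda>_. 0" by simp

lift_definition plus_l2 :: "l2 \<Rightarrow> l2 \<Rightarrow> l2" is "\<lambda>f g x. f x + g x"
proof -
  fix f f' g g' :: "real \<Rightarrow> real"
  assume f: "square_integrable f \<and> square_integrable f' \<and> (AE x in lborel. f x = f' x)"
    and g: "square_integrable g \<and> square_integrable g' \<and> (AE x in lborel. g x = g' x)"
  from f have "AE x in lborel. f x = f' x" by simp
  moreover from g have "AE x in lborel. g x = g' x" by simp
  ultimately have "AE x in lborel. f x + g x = f' x + g' x"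
    by eventually_elim simp
  with f g show "square_integrable (\<lambda>x. f x + g x) \<and> square_integrable (\<lambda>x. f' x + g' x) \<and>
      (AE x in lborel. f x + g x = f' x + g' x)"
    by (simp add: square_integrable_add)
qed

lift_definition scaleR_l2 :: "real \<Rightarrow> l2 \<Rightarrow> l2" is "\<lambda>r f x. r * f x"
  by (simp add: square_integrable_cmult)

lift_definition uminus_l2 :: "l2 \<Rightarrow> l2" is "\<lambda>f x. - f x"
  using square_integrable_cmult[of _ "-1"] by simp

definition minus_l2 :: "l2 \<Rightarrow> l2 \<Rightarrow> l2" where "u - v = u + - v" for u v :: l2

lift_definition inner_l2 :: "l2 \<Rightarrow> l2 \<Rightarrow> real" is "\<lambda>f g. \<integral>x. f x * g x \<partial>lborel"
proof -
  fix f f' g g' :: "real \<Rightarrow> real"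
  assume f: "square_integrable f \<and> square_integrable f' \<and> (AE x in lborel. f x = f' x)"
    and g: "square_integrable g \<and> square_integrable g' \<and> (AE x in lborel. g x = g' x)"
  from f have "AE x in lborel. f x = f' x" by simp
  moreover from g have "AE x in lborel. g x = g' x" by simp
  ultimately have "AE x in lborel. f x * g x = f' x * g' x"
    by eventually_elim simp
  then show "(\<integral>x. f x * g x \<partial>lborel) = (\<integral>x. f' x * g' x \<partial>lborel)"
    using f g by (intro integral_cong_AE) (auto simp: square_integrable_def)
qed

definition norm_l2 :: "l2 \<Rightarrow> real" where "norm_l2 u = sqrt (inner u u)"

definition sgn_l2 :: "l2 \<Rightarrow> l2" where "sgn_l2 u = inverse (norm u) *\<^sub>R u"

definition dist_l2 :: "l2 \<Rightarrow> l2 \<Rightarrow> real" where "dist_l2 u v = norm (u - v)"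

definition uniformity_l2 :: "(l2 \<times> l2) filter" where
  "uniformity_l2 = (INF e\<in>{0 <..}. principal {(u, v). dist u v < e})"

definition open_l2 :: "l2 set \<Rightarrow> bool" where
  "open_l2 U \<longleftrightarrow> (\<forall>u\<in>U. eventually (\<lambda>(u', v). u' = u \<longrightarrow> v \<in> U) uniformity)"

instance
proof
  fix u v w :: l2 and r s :: real
  show "u + v + w = u + (v + w)"
    by transfer (auto simp: add.assoc intro: square_integrable_add)
  show "u + v = v + u"
    by transfer (auto simp: add.commute intro: square_integrable_add)
  show "0 + u = u"
    by transfer auto
  show "- u + u = 0"
    by transfer auto
  show "u - v = u + - v"
    by (rule minus_l2_def)
  show "r *\<^sub>R (u + v) = r *\<^sub>R u + r *\<^sub>R v"
    by transfer (auto simp: distrib_left intro!: square_integrable_add square_integrable_cmult)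
  show "(r + s) *\<^sub>R u = r *\<^sub>R u + s *\<^sub>R u"
    by transfer (auto simp: distrib_right intro!: square_integrable_add square_integrable_cmult)
  show "r *\<^sub>R s *\<^sub>R u = (r * s) *\<^sub>R u"
    by transfer (auto simp: mult.assoc intro!: square_integrable_cmult)
  show "1 *\<^sub>R u = u"
    by transfer auto
  show "sgn u = inverse (norm u) *\<^sub>R u"
    by (rule sgn_l2_def)
  show "dist u v = norm (u - v)"
    by (rule dist_l2_def)
  show "uniformity = (INF e\<in>{0 <..}. principal {(u, v). dist (u::l2) v < e})"
    by (rule uniformity_l2_def)
  show "open U \<longleftrightarrow> (\<forall>u\<in>U. eventually (\<lambda>(u', v). u' = u \<longrightarrow> v \<in> U) uniformity)" for U :: "l2 set"
    by (rule open_l2_def)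
  show "inner u v = inner v u"
    by transfer (simp add: mult.commute)
  show "inner (u + v) w = inner u w + inner v w"
    by transfer (auto simp: distrib_right square_integrable_mult intro!: Bochner_Integration.integral_add)
  show "inner (r *\<^sub>R u) v = r * inner u v"
    by transfer (simp add: mult.assoc)
  show "0 \<le> inner u u"
    by transfer simp
  show "inner u u = 0 \<longleftrightarrow> u = 0"
  proof transfer
    fix f :: "real \<Rightarrow> real"
    assume "square_integrable f \<and> square_integrable f \<and> (AE x in lborel. f x = f x)"
    then have f: "square_integrable f" by simp
    have "(\<integral>x. f x * f x \<partial>lborel) = 0 \<longleftrightarrow> (AE x in lborel. f x * f x = 0)"
      using square_integrable_mult[OF f f] by (intro integral_nonneg_eq_0_iff_AE) auto
    then show "(\<integral>x. f x * f x \<partial>lborel) = 0 \<longleftrightarrow>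
        square_integrable f \<and> square_integrable (\<lambda>_. 0) \<and> (AE x in lborel. f x = 0)"
      using f by simp
  qed
  show "norm u = sqrt (inner u u)"
    by (rule norm_l2_def)
qed

end

text \<open>
  \<open>L2_Ico c\<close> is \<open>L\<^sup>2([0,c))\<close>, realised inside \<open>L\<^sup>2(\<real>)\<close> by extending functions by zero; this
  is isometric, so the metric and topology of \<open>L\<^sup>2([0,c))\<close> are those inherited from \<open>l2\<close>.
\<close>

definition L2_Ico :: "real \<Rightarrow> l2 set" where
  "L2_Ico c = {u. AE x in lborel. x \<notin> {0..<c} \<longrightarrow> l2_fun u x = 0}"

lift_definition l2_concat :: "real \<Rightarrow> real \<Rightarrow> l2 \<Rightarrow> l2 \<Rightarrow> l2" is
  "\<lambda>a b f g x. if x \<in> {0..<a} then f x else if x \<in> {a..<a + b} then g (x - a) else 0"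
proof -
  fix a b :: real and f f' g g' :: "real \<Rightarrow> real"
  let ?h = "\<lambda>f g x. if x \<in> {0..<a} then f x else if x \<in> {a..<a + b} then g (x - a) else 0"
  have sq: "square_integrable (?h f g)"
    if "square_integrable f" "square_integrable g" for f g
  proof -
    have eq: "?h f g = (\<lambda>x. (if x \<in> {0..<a} then f x else 0) +
        (if x \<in> {a..<a + b} - {0..<a} then g (x - a) else 0))"
      by auto
    show ?thesis unfolding eq
      by (intro square_integrable_add square_integrable_restrict square_integrable_shift that) auto
  qed
  assume f: "square_integrable f \<and> square_integrable f' \<and> (AE x in lborel. f x = f' x)"
    and g: "square_integrable g \<and> square_integrable g' \<and> (AE x in lborel. g x = g' x)"
  from g have "AE x in lborel. g (x - a) = g' (x - a)"
    using AE_lborel_shift[of "\<lambda>x. g x = g' x" a] by simp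
  moreover from f have "AE x in lborel. f x = f' x" by simp
  ultimately have "AE x in lborel. ?h f g x = ?h f' g' x"
    by eventually_elim simp
  with f g show "square_integrable (?h f g) \<and> square_integrable (?h f' g') \<and>
      (AE x in lborel. ?h f g x = ?h f' g' x)"
    using sq by auto
qed


section \<open>Words\<close>

definition words :: "'a set \<Rightarrow> 'a list set" where
  "words Y = {xs \<in> lists Y. xs \<noteq> []}"

text \<open>Sequences are indexed so that the positions \<open>1, \<dots>, p\<close> carry the letters of the word.\<close>

definition periodic_ext :: "'a list \<Rightarrow> int \<Rightarrow> 'a" where
  "periodic_ext xs j = xs ! nat ((j - 1) mod int (length xs))"

definition word_dist :: "'a::metric_space list \<Rightarrow> 'a list \<Rightarrow> real" where
  "word_dist xs ys = (SUP j. dist (periodic_ext xs j) (periodic_ext ys j))"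


section \<open>Schroedinger operators and their spectra\<close>

definition potential :: "real \<Rightarrow> (int \<Rightarrow> l2) \<Rightarrow> real \<Rightarrow> real" where
  "potential c y x = (let j = \<lfloor>x / c\<rfloor> in l2_fun (y j) (x - of_int j * c))"

text \<open>\<open>F\<close> is locally absolutely continuous with almost-everywhere derivative \<open>f\<close>.\<close>

definition ac_derivative :: "(real \<Rightarrow> real) \<Rightarrow> (real \<Rightarrow> real) \<Rightarrow> bool" where
  "ac_derivative F f \<longleftrightarrow> (\<forall>s t. s \<le> t \<longrightarrow>
     set_integrable lborel {s..t} f \<and> (LBINT x:{s..t}. f x) = F t - F s)"

text \<open>
  The graph of \<open>-\<partial>\<^sub>x\<^sup>2 + V\<close> on its maximal domain: all \<open>u\<close> in \<open>L\<^sup>2(\<real>)\<close> such that \<open>u\<close> and \<open>u'\<close> are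
  locally absolutely continuous and \<open>- u'' + V u\<close> is in \<open>L\<^sup>2(\<real>)\<close>. For \<open>V\<close> uniformly locally
  square-integrable, in particular for the periodic potentials below, this is the self-adjoint
  realisation, with domain \<open>H\<^sup>2(\<real>)\<close>.
\<close>

definition schroedinger :: "(real \<Rightarrow> real) \<Rightarrow> (l2 \<times> l2) set" where
  "schroedinger V = {(u, v). \<exists>f f' f''.
     (AE x in lborel. l2_fun u x = f x) \<and> ac_derivative f f' \<and> ac_derivative f' f'' \<and>
     (AE x in lborel. l2_fun v x = - f'' x + V x * f x)}"

text \<open>
  \<open>E\<close> is in the resolvent set of the operator with graph \<open>T\<close> iff \<open>T - E\<close> has an everywhere defined
  bounded inverse \<open>R\<close>. As the operators here are self-adjoint, their spectra are real, and for
  real \<open>E\<close> it makes no difference whether the Hilbert space is real or is complexified.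
\<close>

definition resolvent_set :: "('a::real_normed_vector \<times> 'a) set \<Rightarrow> real set" where
  "resolvent_set T = {E. \<exists>R. bounded_linear R \<and>
     (\<forall>u v. (\<exists>w. (u, w) \<in> T \<and> w - E *\<^sub>R u = v) \<longleftrightarrow> u = R v)}"

definition spec :: "('a::real_normed_vector \<times> 'a) set \<Rightarrow> real set" where
  "spec T = - resolvent_set T"

definition word_operator :: "real \<Rightarrow> l2 list \<Rightarrow> (l2 \<times> l2) set" where
  "word_operator c xs = schroedinger (potential c (periodic_ext xs))"


section \<open>Gap-richness\<close>

definition perfect :: "'a::topological_space set \<Rightarrow> bool" where
  "perfect Y \<longleftrightarrow> closed Y \<and> (\<forall>y\<in>Y. \<not> y isolated_in Y)"

definition gap_rich_with :: "real \<Rightarrow> l2 set \<Rightarrow> real set \<Rightarrow> bool" where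
  "gap_rich_with c Y S \<longleftrightarrow> c > 0 \<and> Y \<subseteq> L2_Ico c \<and> perfect Y \<and> discrete S \<and>
     (\<forall>E \<in> - S. \<forall>xs \<in> words Y. \<forall>\<epsilon>>0. \<exists>ys \<in> words Y.
        word_dist xs ys < \<epsilon> \<and> E \<notin> spec (word_operator c ys))"

definition gap_rich :: "real \<Rightarrow> l2 set \<Rightarrow> bool" where
  "gap_rich c Y \<longleftrightarrow> (\<exists>S. gap_rich_with c Y S)"

end

theory Submission
  imports Defs
begin

text \<open>
  No exceptional energies are needed. Change the first letter of a word on a short interval
  \<open>[0, 2h)\<close>, letting the potential minus the energy be \<open>0\<close> or \<open>1\<close> on each half. As \<open>h\<close> tends to
  \<open>0\<close>, this costs arbitrarily little in \<open>L\<^sup>2\<close>, but the four resulting monodromy matrices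
  always form a basis of the \<open>2 \<times> 2\<close> matrices. The semigroup they generate consists of
  the monodromy matrices of concatenations of the four words. If all its traces were
  bounded by \<open>2\<close>, it would be bounded, hence relatively compact, so that its closure would contain
  inverses and commutators. A commutator of two non-commuting unimodular matrices with traces in
  \<open>[-2, 2]\<close> has trace greater than \<open>2\<close>, so the semigroup would be commutative, which is absurd
  for a spanning set. So some concatenation has a hyperbolic monodromy matrix. Its two
  Floquet solutions decay exponentially at \<open>+\<infinity>\<close> and \<open>-\<infinity>\<close>, and their Green function
  inverts the operator minus the energy.
\<close>

text \<open>Lengthening the word is unavoidable: if the trace of a monodromy matrix lies strictly
  between -2 and 2, small changes of the letters keep it there. The metric on words tolerates the
  lengthening, because blocks of the length of the given word are compared with its periodic
  repetition letter by letter. The new steps have heights \<open>E\<close> and \<open>E + 1\<close>,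
  so their transfer matrices do not depend on \<open>E\<close> and are available at every energy;
  \<open>E\<close> enters only the cost, through the bound \<open>\<bar>E\<bar> + 1\<close> on the
  heights. One step would give only two matrices, too few to span a four-dimensional space; two
  steps give four products. A spanning set serves twice. The form \<open>trace (X ** Y)\<close> is
  nondegenerate, so four bounded traces bound all entries of \<open>X\<close>; and a matrix that
  commutes with a spanning set commutes with everything. The remainder of the first letter and the
  other letters contribute one common unimodular factor, which maps a basis to a basis.\<close>

section \<open>Calculus of absolutely continuous functions\<close>

definition locally_integrable :: "(real \<Rightarrow> real) \<Rightarrow> bool" where
  "locally_integrable f \<longleftrightarrow> (\<forall>s t. set_integrable lborel {s..t} f)"

lemma locally_integrableD: "locally_integrable f \<Longrightarrow> set_integrable lborel {s..t} f"
  by (simp add: locally_integrable_def)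

lemma locally_integrable_continuous: "continuous_on UNIV f \<Longrightarrow> locally_integrable f"
  unfolding locally_integrable_def
  by (auto intro!: borel_integrable_atLeastAtMost' elim: continuous_on_subset)

lemma locally_integrable_add:
  "locally_integrable f \<Longrightarrow> locally_integrable g \<Longrightarrow> locally_integrable (\<lambda>x. f x + g x)"
  unfolding locally_integrable_def by auto

lemma locally_integrable_diff:
  "locally_integrable f \<Longrightarrow> locally_integrable g \<Longrightarrow> locally_integrable (\<lambda>x. f x - g x)"
  unfolding locally_integrable_def by auto

lemma locally_integrable_cmult: "locally_integrable f \<Longrightarrow> locally_integrable (\<lambda>x. r * f x)"
  unfolding locally_integrable_def by auto

lemma locally_integrable_abs: "locally_integrable f \<Longrightarrow> locally_integrable (\<lambda>x. \<bar>f x\<bar>)"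
  unfolding locally_integrable_def by (auto intro: set_integrable_abs)

lemma locally_integrable_mult_continuous:
  assumes f: "locally_integrable f" and g: "continuous_on UNIV g"
  shows "locally_integrable (\<lambda>x. f x * g x)"
  unfolding locally_integrable_def
proof (intro allI)
  fix s t :: real
  have "compact (g ` {s..t})"
    by (intro compact_continuous_image continuous_on_subset[OF g]) auto
  from compact_imp_bounded[OF this] obtain C where C: "\<And>x. x \<in> {s..t} \<Longrightarrow> \<bar>g x\<bar> \<le> C"
    by (force simp: bounded_iff)
  have [measurable]: "g \<in> borel_measurable borel"
    using g by (rule borel_measurable_continuous_onI)
  have int: "integrable lborel (\<lambda>x. indicator {s..t} x *\<^sub>R f x)"
    using f by (simp add: locally_integrable_def set_integrable_def)
  then have [measurable]: "(\<lambda>x. indicator {s..t} x *\<^sub>R f x) \<in> borel_measurable borel"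
    by auto
  show "set_integrable lborel {s..t} (\<lambda>x. f x * g x)"
    unfolding set_integrable_def
  proof (rule Bochner_Integration.integrable_bound)
    show "integrable lborel (\<lambda>x. C * (indicator {s..t} x *\<^sub>R f x))"
      using int by (rule integrable_mult_right)
    have "(\<lambda>x. (indicator {s..t} x *\<^sub>R f x) * g x) \<in> borel_measurable lborel"
      by measurable
    then show "(\<lambda>x. indicator {s..t} x *\<^sub>R (f x * g x)) \<in> borel_measurable lborel"
      by (simp add: mult.assoc)
    have "\<bar>f x * g x\<bar> \<le> \<bar>C * f x\<bar>" if "x \<in> {s..t}" for x
    proof -
      have "\<bar>g x\<bar> \<le> \<bar>C\<bar>" using C[OF that] by linarith
      then have "\<bar>f x\<bar> * \<bar>g x\<bar> \<le> \<bar>f x\<bar> * \<bar>C\<bar>" by (intro mult_left_mono) auto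
      then show ?thesis by (simp add: abs_mult mult.commute)
    qed
    then show "AE x in lborel. norm (indicator {s..t} x *\<^sub>R (f x * g x))
        \<le> norm (C * (indicator {s..t} x *\<^sub>R f x))"
      by (auto split: split_indicator)
  qed
qed

lemma locally_integrable_continuous_mult:
  "continuous_on UNIV g \<Longrightarrow> locally_integrable f \<Longrightarrow> locally_integrable (\<lambda>x. g x * f x)"
  using locally_integrable_mult_continuous[of f g] by (simp add: mult.commute)

lemma ac_derivative_locally_integrable: "ac_derivative F f \<Longrightarrow> locally_integrable f"
proof -
  assume a: "ac_derivative F f"
  have "set_integrable lborel {s..t} f" for s t
    using a by (cases "s \<le> t") (auto simp: ac_derivative_def)
  then show ?thesis by (simp add: locally_integrable_def)
qed

lemma ac_derivative_LBINT:
  "ac_derivative F f \<Longrightarrow> s \<le> t \<Longrightarrow> (LBINT x:{s..t}. f x) = F t - F s"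
  by (simp add: ac_derivative_def)

lemma ac_derivativeI:
  assumes "locally_integrable f" "\<And>s t. s \<le> t \<Longrightarrow> (LBINT x:{s..t}. f x) = F t - F s"
  shows "ac_derivative F f"
  using assms by (auto simp: ac_derivative_def locally_integrable_def)

lemma ac_derivative_continuous:
  assumes F: "ac_derivative F f"
  shows "continuous_on UNIV F"
proof -
  have "isCont F x" for x
  proof -
    let ?s = "x - 1" and ?t = "x + 1"
    note i = locally_integrableD[OF ac_derivative_locally_integrable[OF F]]
    have "continuous_on {?s..?t} (\<lambda>y. F ?s + integral {?s..y} f)"
      by (intro continuous_intros indefinite_integral_continuous_1 set_borel_integral_eq_integral i)
    moreover have "F ?s + integral {?s..y} f = F y" if "y \<in> {?s..?t}" for y
      using ac_derivative_LBINT[OF F, of ?s y] set_borel_integral_eq_integral(2)[OF i, of ?s y] that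
      by simp
    ultimately have "continuous_on {?s..?t} F"
      by (rule continuous_on_eq)
    then have "continuous_on {?s<..<?t} F"
      by (rule continuous_on_subset) auto
    then show ?thesis
      by (subst (asm) continuous_on_eq_continuous_at) auto
  qed
  then show ?thesis by (simp add: continuous_on_eq_continuous_at)
qed

text \<open>\<open>schroedinger\<close> determines second derivatives only up to null sets, whereas
  \<open>schroedinger_solution\<close> prescribes the right-hand side exactly; this bridges the
  two.\<close>

lemma ac_derivative_cong_AE:
  assumes F: "ac_derivative F f" and g: "locally_integrable g" and ae: "AE x in lborel. f x = g x"
  shows "ac_derivative F g"
proof (rule ac_derivativeI[OF g])
  fix s t :: real assume st: "s \<le> t"
  note f = ac_derivative_locally_integrable[OF F]
  have "(LBINT x:{s..t}. g x) = (LBINT x:{s..t}. f x)"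
    unfolding set_lebesgue_integral_def
    using locally_integrableD[OF f, of s t] locally_integrableD[OF g, of s t] ae
    by (intro integral_cong_AE) (auto simp: set_integrable_def)
  then show "(LBINT x:{s..t}. g x) = F t - F s"
    using ac_derivative_LBINT[OF F st] by simp
qed

lemma ac_derivative_zero_imp_eq:
  assumes F: "ac_derivative F f" and st: "s \<le> t" and ae: "AE x in lborel. x \<in> {s..t} \<longrightarrow> f x = 0"
  shows "F t = F s"
proof -
  note f = ac_derivative_locally_integrable[OF F]
  have "(LBINT x:{s..t}. f x) = (LBINT x:{s..t}. 0)"
    unfolding set_lebesgue_integral_def
    using locally_integrableD[OF f, of s t] ae
    by (intro integral_cong_AE) (auto simp: set_integrable_def split: split_indicator)
  then show ?thesis using ac_derivative_LBINT[OF F st] by (simp add: set_lebesgue_integral_def)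
qed

lemma ac_derivative_const: "ac_derivative (\<lambda>_. r) (\<lambda>_. 0)"
  by (rule ac_derivativeI) (auto intro!: locally_integrable_continuous simp: set_lebesgue_integral_def)

lemma ac_derivative_add:
  assumes "ac_derivative F f" "ac_derivative G g"
  shows "ac_derivative (\<lambda>x. F x + G x) (\<lambda>x. f x + g x)"
proof (rule ac_derivativeI)
  note i = assms[THEN ac_derivative_locally_integrable]
  show "locally_integrable (\<lambda>x. f x + g x)" using i by (rule locally_integrable_add)
  show "(LBINT x:{s..t}. f x + g x) = F t + G t - (F s + G s)" if "s \<le> t" for s t
    using i[THEN locally_integrableD] ac_derivative_LBINT[OF assms(1) that]
      ac_derivative_LBINT[OF assms(2) that] by simp
qed

lemma ac_derivative_cmult:
  assumes "ac_derivative F f"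
  shows "ac_derivative (\<lambda>x. r * F x) (\<lambda>x. r * f x)"
proof (rule ac_derivativeI)
  show "locally_integrable (\<lambda>x. r * f x)"
    by (intro locally_integrable_cmult ac_derivative_locally_integrable[OF assms])
  show "(LBINT x:{s..t}. r * f x) = r * F t - r * F s" if "s \<le> t" for s t
    using ac_derivative_LBINT[OF assms that] by (simp add: right_diff_distrib)
qed

lemma ac_derivative_diff:
  assumes "ac_derivative F f" "ac_derivative G g"
  shows "ac_derivative (\<lambda>x. F x - G x) (\<lambda>x. f x - g x)"
  using ac_derivative_add[OF assms(1) ac_derivative_cmult[OF assms(2), of "-1"]] by simp

lemma ac_derivative_shift:
  assumes F: "ac_derivative F f"
  shows "ac_derivative (\<lambda>x. F (x + r)) (\<lambda>x. f (x + r))"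
proof -
  have eq: "(\<lambda>x. indicator {s..t} x *\<^sub>R f (x + r)) =
      (\<lambda>x. indicator {s + r..t + r} (r + 1 * x) *\<^sub>R f (r + 1 * x))" for s t
    by (auto simp: fun_eq_iff add.commute split: split_indicator)
  show ?thesis
  proof (rule ac_derivativeI)
    show "locally_integrable (\<lambda>x. f (x + r))"
      unfolding locally_integrable_def set_integrable_def eq
      using locally_integrableD[OF ac_derivative_locally_integrable[OF F]]
      by (intro allI lborel_integrable_real_affine) (auto simp: set_integrable_def)
    show "(LBINT x:{s..t}. f (x + r)) = F (t + r) - F (s + r)" if "s \<le> t" for s t
    proof -
      have "(LBINT x:{s..t}. f (x + r)) = (LBINT x:{s + r..t + r}. f x)"
        unfolding set_lebesgue_integral_def eq
        using lborel_integral_real_affine[of 1 "\<lambda>x. indicator {s + r..t + r} x *\<^sub>R f x" r] by simp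
      then show ?thesis using ac_derivative_LBINT[OF F, of "s + r" "t + r"] that by simp
    qed
  qed
qed

lemma ac_derivative_has_derivative:
  assumes "\<And>x. (F has_real_derivative f x) (at x)" and f: "continuous_on UNIV f"
  shows "ac_derivative F f"
proof (rule ac_derivativeI[OF locally_integrable_continuous[OF f]])
  fix s t :: real assume "s \<le> t"
  then show "(LBINT x:{s..t}. f x) = F t - F s"
    unfolding set_lebesgue_integral_def
    using assms by (intro integral_FTC_Icc continuous_on_subset[OF f])
      (auto simp: has_real_derivative_iff_has_vector_derivative intro: has_vector_derivative_at_within)
qed

section \<open>Fubini and the product rule\<close>

lemma integrable_product_fun:
  fixes f g :: "real \<Rightarrow> real"
  assumes f: "integrable lborel f" and g: "integrable lborel g"
  shows "integrable (lborel \<Otimes>\<^sub>M lborel) (\<lambda>(x, y). f x * g y)"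
proof -
  have [measurable]: "f \<in> borel_measurable lborel" "g \<in> borel_measurable lborel"
    using f g by auto
  show ?thesis
    by (rule lborel_pair.Fubini_integrable) (use f g in \<open>auto simp: abs_mult\<close>)
qed

text \<open>Both sides are the integral of \<open>f x * g y\<close> over the triangle \<open>s \<le> y \<le> x \<le> t\<close>.\<close>

lemma ac_derivative_triangle:
  assumes F: "ac_derivative F f" and G: "ac_derivative G g" and st: "s \<le> t"
  shows "(LBINT x:{s..t}. f x * (G x - G s)) = (LBINT y:{s..t}. g y * (F t - F y))"
proof -
  define f1 g1 where "f1 x = indicator {s..t} x *\<^sub>R f x" and "g1 x = indicator {s..t} x *\<^sub>R g x" for x
  have int: "integrable lborel f1" "integrable lborel g1"
    using locally_integrableD[OF ac_derivative_locally_integrable[OF F], of s t]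
      locally_integrableD[OF ac_derivative_locally_integrable[OF G], of s t]
    by (simp_all add: set_integrable_def f1_def[abs_def] g1_def[abs_def])
  have [measurable]: "f1 \<in> borel_measurable borel" "g1 \<in> borel_measurable borel"
    using int by auto
  let ?h = "\<lambda>x y. if y \<le> x then f1 x * g1 y else 0"
  have "integrable (lborel \<Otimes>\<^sub>M lborel) (case_prod ?h)"
  proof (rule Bochner_Integration.integrable_bound[OF integrable_product_fun[OF int]])
    have "Measurable.pred (lborel \<Otimes>\<^sub>M lborel) (\<lambda>z. snd z \<le> (fst z :: real))" by measurable
    then show "case_prod ?h \<in> borel_measurable (lborel \<Otimes>\<^sub>M lborel)"
      by (simp add: case_prod_beta) 
  qed auto
  from lborel_pair.Fubini_integral[OF this]
  have "(\<integral>y. (\<integral>x. ?h x y \<partial>lborel) \<partial>lborel) = (\<integral>x. (\<integral>y. ?h x y \<partial>lborel) \<partial>lborel)" .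
  moreover have "(\<integral>y. ?h x y \<partial>lborel) = indicator {s..t} x *\<^sub>R (f x * (G x - G s))" for x
  proof (cases "x \<in> {s..t}")
    case True
    have "(\<integral>y. ?h x y \<partial>lborel) = (\<integral>y. f x * (indicator {s..x} y *\<^sub>R g y) \<partial>lborel)"
      using True by (intro Bochner_Integration.integral_cong) (auto simp: f1_def g1_def split: split_indicator)
    also have "\<dots> = f x * (LBINT y:{s..x}. g y)"
      by (simp add: set_lebesgue_integral_def)
    finally show ?thesis using True ac_derivative_LBINT[OF G, of s x] by simp
  qed (simp add: f1_def cong: if_cong)
  moreover have "(\<integral>x. ?h x y \<partial>lborel) = indicator {s..t} y *\<^sub>R (g y * (F t - F y))" for y
  proof (cases "y \<in> {s..t}")
    case True
    have "(\<integral>x. ?h x y \<partial>lborel) = (\<integral>x. g y * (indicator {y..t} x *\<^sub>R f x) \<partial>lborel)"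
      using True by (intro Bochner_Integration.integral_cong) (auto simp: f1_def g1_def split: split_indicator)
    also have "\<dots> = g y * (LBINT x:{y..t}. f x)"
      by (simp add: set_lebesgue_integral_def)
    finally show ?thesis using True ac_derivative_LBINT[OF F, of y t] by simp
  qed (simp add: g1_def cong: if_cong)
  ultimately show ?thesis
    by (simp add: set_lebesgue_integral_def)
qed

text \<open>With derivatives known only through integrals, the product rule is integration by parts:
  expand both sides of \<open>ac_derivative_triangle\<close> and collect the two integrals of
  products.\<close>

lemma ac_derivative_mult:
  assumes F: "ac_derivative F f" and G: "ac_derivative G g"
  shows "ac_derivative (\<lambda>x. F x * G x) (\<lambda>x. f x * G x + F x * g x)"
proof (rule ac_derivativeI)
  note cF = ac_derivative_continuous[OF F] and cG = ac_derivative_continuous[OF G]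
  note lf = ac_derivative_locally_integrable[OF F] and lg = ac_derivative_locally_integrable[OF G]
  note lfG = locally_integrable_mult_continuous[OF lf cG]
  note lFg = locally_integrable_continuous_mult[OF cF lg]
  show "locally_integrable (\<lambda>x. f x * G x + F x * g x)"
    by (rule locally_integrable_add[OF lfG lFg])
  fix s t :: real assume st: "s \<le> t"
  have "(LBINT x:{s..t}. f x * (G x - G s)) = (LBINT x:{s..t}. f x * G x) - G s * (F t - F s)"
    using locally_integrableD[OF lfG] locally_integrableD[OF locally_integrable_cmult[OF lf, of "G s"]]
    by (simp add: right_diff_distrib mult.commute[of _ "G s"] set_integral_diff ac_derivative_LBINT[OF F st])
  moreover have "(LBINT x:{s..t}. g x * (F t - F x)) = F t * (G t - G s) - (LBINT x:{s..t}. F x * g x)"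
    using locally_integrableD[OF lFg] locally_integrableD[OF locally_integrable_cmult[OF lg, of "F t"]]
    by (simp add: right_diff_distrib mult.commute[of "g _"] set_integral_diff ac_derivative_LBINT[OF G st])
  moreover have "(LBINT x:{s..t}. f x * G x + F x * g x) = (LBINT x:{s..t}. f x * G x) + (LBINT x:{s..t}. F x * g x)"
    using locally_integrableD[OF lfG] locally_integrableD[OF lFg] by (rule set_integral_add)
  ultimately show "(LBINT x:{s..t}. f x * G x + F x * g x) = F t * G t - F s * G s"
    using ac_derivative_triangle[OF F G st] by (simp add: algebra_simps)
qed

section \<open>Primitives, series and iterated integrals\<close>

text \<open>The oriented integral from 0 to \<open>x\<close>: at least one of the two intervals is
  empty or a point.\<close>

definition primitive :: "(real \<Rightarrow> real) \<Rightarrow> real \<Rightarrow> real" where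
  "primitive f x = (LBINT t:{0..x}. f t) - (LBINT t:{x..0}. f t)"

lemma LBINT_combine:
  assumes f: "locally_integrable f" and "s \<le> t" "t \<le> r"
  shows "(LBINT x:{s..t}. f x) + (LBINT x:{t..r}. f x) = (LBINT x:{s..r}. f x)"
  using assms(2,3) set_borel_integral_eq_integral[OF locally_integrableD[OF f]]
  by (simp add: Henstock_Kurzweil_Integration.integral_combine)

lemma primitive_0 [simp]: "primitive f 0 = 0"
  by (simp add: primitive_def)

lemma LBINT_trivial: "t \<le> s \<Longrightarrow> locally_integrable f \<Longrightarrow> (LBINT x:{s..t}. f x) = 0"
  using LBINT_combine[of f s s s]
  by (cases "s = t") (auto simp: set_lebesgue_integral_def)

lemma ac_derivative_primitive:
  assumes f: "locally_integrable f"
  shows "ac_derivative (primitive f) f"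
proof (rule ac_derivativeI[OF f])
  fix s t :: real assume st: "s \<le> t"
  note tr = LBINT_trivial[OF _ f]
  consider "0 \<le> s" | "s \<le> 0" "0 \<le> t" | "t \<le> 0" by linarith
  then show "(LBINT x:{s..t}. f x) = primitive f t - primitive f s"
  proof cases
    case 1
    then show ?thesis
      using st LBINT_combine[OF f, of 0 s t] by (simp add: primitive_def tr)
  next
    case 2
    then show ?thesis
      using LBINT_combine[OF f, of s 0 t] by (simp add: primitive_def tr)
  next
    case 3
    then show ?thesis
      using st LBINT_combine[OF f, of s t 0] by (simp add: primitive_def tr)
  qed
qed

lemma LBINT_abs_le:
  assumes g: "locally_integrable g" and h: "locally_integrable h"
    and le: "\<And>x. x \<in> {s..t} \<Longrightarrow> \<bar>g x\<bar> \<le> h x"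
  shows "\<bar>LBINT x:{s..t}. g x\<bar> \<le> (LBINT x:{s..t}. h x)"
proof -
  note gi = locally_integrableD[OF g, of s t] and hi = locally_integrableD[OF h, of s t]
  have "(LBINT x:{s..t}. g x) \<le> (LBINT x:{s..t}. h x)"
    by (rule set_integral_mono[OF gi hi]) (use le in force)
  moreover have "(LBINT x:{s..t}. (-1) * g x) \<le> (LBINT x:{s..t}. h x)"
    by (rule set_integral_mono[OF _ hi]) (use le gi in \<open>force intro!: set_integrable_mult_right\<close>)+
  ultimately show ?thesis using set_integral_uminus[OF gi] by simp
qed

text \<open>Termwise integration by domination. The common factor \<open>k\<close> absorbs the
  unboundedness of a merely locally integrable coefficient; the summable factor \<open>b\<close> may
  depend on the interval, as the Picard bounds are uniform only on bounded intervals.\<close>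

lemma ac_derivative_suminf:
  fixes F f :: "nat \<Rightarrow> real \<Rightarrow> real"
  assumes F: "\<And>n. ac_derivative (F n) (f n)"
    and k: "locally_integrable k"
    and bd: "\<And>s t. \<exists>b. summable b \<and> (\<forall>n. 0 \<le> b n) \<and> (\<forall>n. \<forall>x\<in>{s..t}. \<bar>f n x\<bar> \<le> b n * k x)"
    and sF: "\<And>x. summable (\<lambda>n. F n x)"
  shows "ac_derivative (\<lambda>x. \<Sum>n. F n x) (\<lambda>x. \<Sum>n. f n x)"
proof -
  have main: "set_integrable lborel {s..t} (\<lambda>x. \<Sum>n. f n x) \<and>
     (s \<le> t \<longrightarrow> (LBINT x:{s..t}. \<Sum>n. f n x) = (\<Sum>n. F n t) - (\<Sum>n. F n s))" for s t
  proof -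
    define f1 where "f1 n x = indicator {s..t} x *\<^sub>R f n x" for n x
    define k1 where "k1 x = indicator {s..t} x *\<^sub>R k x" for x
    from bd[of s t] obtain b where b: "summable b" "\<And>n. 0 \<le> b n"
      and fb: "\<And>n x. x \<in> {s..t} \<Longrightarrow> \<bar>f n x\<bar> \<le> b n * k x" by blast
    have f1: "integrable lborel (f1 n)" for n
      using locally_integrableD[OF ac_derivative_locally_integrable[OF F], of s t n]
      by (simp add: set_integrable_def f1_def[abs_def])
    have k1: "integrable lborel k1"
      using locally_integrableD[OF k, of s t] by (simp add: set_integrable_def k1_def[abs_def])
    have le: "norm (f1 n x) \<le> b n * k1 x" for n x
      using fb[of x n] by (auto simp: f1_def k1_def split: split_indicator)
    have sum1: "AE x in lborel. summable (\<lambda>n. norm (f1 n x))"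
    proof (rule AE_I2)
      show "summable (\<lambda>n. norm (f1 n x))" for x
        using le by (intro summable_comparison_test'[OF summable_mult2[OF b(1), of "k1 x"], where N = 0]) simp
    qed
    have sum2: "summable (\<lambda>n. \<integral>x. norm (f1 n x) \<partial>lborel)"
    proof (rule summable_comparison_test'[OF summable_mult2[OF b(1), of "\<integral>x. k1 x \<partial>lborel"], where N = 0])
      fix n
      have "(\<integral>x. norm (f1 n x) \<partial>lborel) \<le> (\<integral>x. b n * k1 x \<partial>lborel)"
        by (intro integral_mono integrable_norm f1 integrable_mult_right k1 le)
      then show "norm (\<integral>x. norm (f1 n x) \<partial>lborel) \<le> b n * (\<integral>x. k1 x \<partial>lborel)"
        by simp
    qed
    have eq: "(\<Sum>n. f1 n x) = indicator {s..t} x *\<^sub>R (\<Sum>n. f n x)" for x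
      by (auto simp: f1_def split: split_indicator)
    have 1: "set_integrable lborel {s..t} (\<lambda>x. \<Sum>n. f n x)"
      using integrable_suminf[OF f1 sum1 sum2] unfolding eq set_integrable_def .
    have "(LBINT x:{s..t}. \<Sum>n. f n x) = (\<Sum>n. F n t) - (\<Sum>n. F n s)" if "s \<le> t"
    proof -
      have "(LBINT x:{s..t}. \<Sum>n. f n x) = (\<Sum>n. \<integral>x. f1 n x \<partial>lborel)"
        using integral_suminf[OF f1 sum1 sum2] unfolding eq set_lebesgue_integral_def .
      also have "(\<lambda>n. \<integral>x. f1 n x \<partial>lborel) = (\<lambda>n. F n t - F n s)"
        using ac_derivative_LBINT[OF F that] by (simp add: f1_def set_lebesgue_integral_def)
      also have "(\<Sum>n. F n t - F n s) = (\<Sum>n. F n t) - (\<Sum>n. F n s)"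
        by (rule suminf_diff[OF sF sF, symmetric])
      finally show ?thesis .
    qed
    with 1 show ?thesis by blast
  qed
  then show ?thesis by (simp add: ac_derivative_def)
qed

text \<open>The source of the factorials that make the Picard series converge.\<close>

lemma ac_derivative_power:
  assumes K: "ac_derivative K k"
  shows "ac_derivative (\<lambda>x. K x ^ Suc n / fact (Suc n)) (\<lambda>x. k x * (K x ^ n / fact n))"
proof (induction n)
  case 0
  then show ?case using K by simp
next
  case (Suc n)
  \<comment> \<open>The product rule for \<open>K\<close> times the previous term yields 1 + (n + 1)
    copies of the wanted derivative, which the factor \<open>1 / real (n + 2)\<close>
    normalises.\<close>
  have "ac_derivative (\<lambda>x. (1 / real (n + 2)) * (K x * (K x ^ Suc n / fact (Suc n))))
     (\<lambda>x. (1 / real (n + 2)) * (k x * (K x ^ Suc n / fact (Suc n)) + K x * (k x * (K x ^ n / fact n))))"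
    by (intro ac_derivative_cmult ac_derivative_mult K Suc)
  moreover have "(1 / real (n + 2)) * (K x * (K x ^ Suc n / fact (Suc n))) = K x ^ Suc (Suc n) / fact (Suc (Suc n))" for x
    by (simp add: field_simps)
  moreover have "(1 / real (n + 2)) * (k x * (K x ^ Suc n / fact (Suc n)) + K x * (k x * (K x ^ n / fact n)))
     = k x * (K x ^ Suc n / fact (Suc n))" for x
    by (simp add: divide_simps) (simp add: algebra_simps)
  ultimately show ?case by (simp only:)
qed

text \<open>One Picard step: integrating a bound of order \<open>n\<close> yields the bound of order
  \<open>n + 1\<close>, because \<open>k * K ^ n / fact n\<close> is an exact derivative.\<close>

lemma primitive_bound:
  assumes k: "locally_integrable k" "\<And>x. 0 \<le> k x" and g: "locally_integrable g"
    and le: "\<And>x. \<bar>g x\<bar> \<le> C * (k x * (\<bar>primitive k x\<bar> ^ n / fact n))"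
  shows "\<bar>primitive g x\<bar> \<le> C * (\<bar>primitive k x\<bar> ^ Suc n / fact (Suc n))"
proof -
  let ?K = "primitive k"
  note K = ac_derivative_primitive[OF k(1)] and G = ac_derivative_primitive[OF g]
  have mono: "?K s \<le> ?K t" if "s \<le> t" for s t
    using ac_derivative_LBINT[OF K that] LBINT_abs_le[of "\<lambda>_. 0" k s t]
      locally_integrable_continuous[of "\<lambda>_. 0"] k by simp
  show ?thesis
  proof (cases "0 \<le> x")
    case True
    note H = ac_derivative_cmult[OF ac_derivative_power[OF K], of C n]
    have "\<bar>primitive g x\<bar> = \<bar>LBINT t:{0..x}. g t\<bar>"
      using ac_derivative_LBINT[OF G True] by simp
    also have "\<dots> \<le> (LBINT t:{0..x}. C * (k t * (?K t ^ n / fact n)))"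
    proof (rule LBINT_abs_le[OF g ac_derivative_locally_integrable[OF H]])
      fix t assume "t \<in> {0..x}"
      then have "0 \<le> ?K t" using mono[of 0 t] by simp
      then show "\<bar>g t\<bar> \<le> C * (k t * (?K t ^ n / fact n))" using le[of t] by simp
    qed
    also have "\<dots> = C * (\<bar>?K x\<bar> ^ Suc n / fact (Suc n))"
      using ac_derivative_LBINT[OF H True] mono[OF True] by simp
    finally show ?thesis .
  next
    case False
    then have x: "x \<le> 0" by simp
    \<comment> \<open>Left of 0 the primitive is nonpositive, so the power rule is applied to its
      negative; the sign in \<open>-C\<close> compensates for the derivative
      \<open>-1 * k\<close>.\<close>
    note H = ac_derivative_cmult[OF ac_derivative_power[OF ac_derivative_cmult[OF K, of "-1"]], of "-C" n]
    have "\<bar>primitive g x\<bar> = \<bar>LBINT t:{x..0}. g t\<bar>"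
      using ac_derivative_LBINT[OF G x] by simp
    also have "\<dots> \<le> (LBINT t:{x..0}. -C * (-1 * k t * ((-1 * ?K t) ^ n / fact n)))"
    proof (rule LBINT_abs_le[OF g ac_derivative_locally_integrable[OF H]])
      fix t assume "t \<in> {x..0}"
      then have "?K t \<le> 0" using mono[of t 0] by simp
      then show "\<bar>g t\<bar> \<le> -C * (-1 * k t * ((-1 * ?K t) ^ n / fact n))" using le[of t] by simp
    qed
    also have "\<dots> = C * (\<bar>?K x\<bar> ^ Suc n / fact (Suc n))"
      using ac_derivative_LBINT[OF H x] mono[OF x] by simp
    finally show ?thesis .
  qed
qed

section \<open>Solutions of the Schroedinger equation\<close>

text \<open>The equation u'' = W u as a first-order system, with \<open>v\<close> in the role of u'
  and \<open>W\<close> in that of potential minus energy. Derivatives are taken in the integrated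
  sense because \<open>W\<close> is in general only locally integrable.\<close>

definition schroedinger_solution :: "(real \<Rightarrow> real) \<Rightarrow> (real \<Rightarrow> real) \<Rightarrow> (real \<Rightarrow> real) \<Rightarrow> bool" where
  "schroedinger_solution W u v \<longleftrightarrow> ac_derivative u v \<and> ac_derivative v (\<lambda>x. W x * u x)"

text \<open>These are the terms of the iterated-integral series of the first-order system, not its
  partial sums.\<close>

primrec picard :: "(real \<Rightarrow> real) \<Rightarrow> real \<Rightarrow> real \<Rightarrow> nat \<Rightarrow> (real \<Rightarrow> real) \<times> (real \<Rightarrow> real)" where
  "picard W \<alpha> \<beta> 0 = (\<lambda>_. \<alpha>, \<lambda>_. \<beta>)"
| "picard W \<alpha> \<beta> (Suc n) =
    (primitive (snd (picard W \<alpha> \<beta> n)), primitive (\<lambda>x. W x * fst (picard W \<alpha> \<beta> n) x))"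

lemma picard_continuous:
  assumes W: "locally_integrable W"
  shows "continuous_on UNIV (fst (picard W \<alpha> \<beta> n)) \<and> continuous_on UNIV (snd (picard W \<alpha> \<beta> n))"
proof (induction n)
  case (Suc n)
  then have "locally_integrable (snd (picard W \<alpha> \<beta> n))"
    "locally_integrable (\<lambda>x. W x * fst (picard W \<alpha> \<beta> n) x)"
    by (auto intro: locally_integrable_continuous locally_integrable_mult_continuous[OF W])
  then show ?case
    by (auto intro: ac_derivative_continuous[OF ac_derivative_primitive])
qed simp

text \<open>\<open>k\<close> dominates both nonzero coefficients 1 and \<open>W\<close> of the
  first-order system, so a single majorant handles both components.\<close>

lemma picard_bound:
  fixes \<alpha> \<beta> :: real
  assumes W: "locally_integrable W"
  defines "k \<equiv> \<lambda>x. 1 + \<bar>W x\<bar>" and "C \<equiv> \<bar>\<alpha>\<bar> + \<bar>\<beta>\<bar>"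
  shows "\<bar>fst (picard W \<alpha> \<beta> n) x\<bar> \<le> C * (\<bar>primitive k x\<bar> ^ n / fact n) \<and>
    \<bar>snd (picard W \<alpha> \<beta> n) x\<bar> \<le> C * (\<bar>primitive k x\<bar> ^ n / fact n)"
proof (induction n arbitrary: x)
  case 0
  then show ?case by (simp add: C_def)
next
  case (Suc n)
  have k: "locally_integrable k"
    unfolding k_def by (intro locally_integrable_add locally_integrable_abs W locally_integrable_continuous) auto
  have k0: "0 \<le> k x" for x by (simp add: k_def)
  let ?B = "\<lambda>x. C * (\<bar>primitive k x\<bar> ^ n / fact n)"
  have B0: "0 \<le> ?B x" for x by (simp add: C_def)
  note c = picard_continuous[OF W, of \<alpha> \<beta> n]
  have 1: "\<bar>snd (picard W \<alpha> \<beta> n) x\<bar> \<le> C * (k x * (\<bar>primitive k x\<bar> ^ n / fact n))" for x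
  proof -
    have "1 * ?B x \<le> k x * ?B x" by (rule mult_right_mono[OF _ B0]) (simp add: k_def)
    then show ?thesis using Suc[of x] by (simp add: mult_ac)
  qed
  have 2: "\<bar>W x * fst (picard W \<alpha> \<beta> n) x\<bar> \<le> C * (k x * (\<bar>primitive k x\<bar> ^ n / fact n))" for x
  proof -
    have "\<bar>W x\<bar> * \<bar>fst (picard W \<alpha> \<beta> n) x\<bar> \<le> k x * ?B x"
      using Suc[of x] B0[of x] by (intro mult_mono) (auto simp: k_def)
    then show ?thesis by (simp add: abs_mult mult_ac)
  qed
  have l1: "locally_integrable (snd (picard W \<alpha> \<beta> n))"
    and l2: "locally_integrable (\<lambda>x. W x * fst (picard W \<alpha> \<beta> n) x)"
    using c by (auto intro: locally_integrable_continuous locally_integrable_mult_continuous[OF W])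
  show ?case
    using primitive_bound[OF k k0 l1 1, of x] primitive_bound[OF k k0 l2 2, of x] by simp
qed

lemma summable_scaled_exp: "summable (\<lambda>n. C * (x ^ n / fact n))" for x :: real
  using summable_mult[OF summable_exp[of x], of C] by (simp add: field_simps)

lemma schroedinger_solution_exists_0:
  assumes W: "locally_integrable W"
  shows "\<exists>u v. schroedinger_solution W u v \<and> u 0 = \<alpha> \<and> v 0 = \<beta>"
proof -
  define k where "k = (\<lambda>x. 1 + \<bar>W x\<bar>)"
  define C where "C = \<bar>\<alpha>\<bar> + \<bar>\<beta>\<bar>"
  define U where "U n = fst (picard W \<alpha> \<beta> n)" for n
  define V where "V n = snd (picard W \<alpha> \<beta> n)" for n
  let ?K = "primitive k"
  have k: "locally_integrable k"
    unfolding k_def by (intro locally_integrable_add locally_integrable_abs W locally_integrable_continuous) auto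
  have bU: "\<bar>U n x\<bar> \<le> C * (\<bar>?K x\<bar> ^ n / fact n)" and bV: "\<bar>V n x\<bar> \<le> C * (\<bar>?K x\<bar> ^ n / fact n)" for n x
    using picard_bound[OF W, of \<alpha> \<beta> n x] by (simp_all add: U_def V_def k_def C_def)
  have sU: "summable (\<lambda>n. U n x)" and sV: "summable (\<lambda>n. V n x)" for x
    using bU bV by (auto intro!: summable_comparison_test'[OF summable_scaled_exp, where N = 0])
  have cU: "continuous_on UNIV (U n)" and cV: "continuous_on UNIV (V n)" for n
    using picard_continuous[OF W, of \<alpha> \<beta> n] by (simp_all add: U_def V_def)
  have S: "U (Suc n) = primitive (V n)" "V (Suc n) = primitive (\<lambda>x. W x * U n x)" for n
    by (simp_all add: U_def V_def)
  \<comment> \<open>On a bounded interval \<open>\<bar>?K x\<bar>\<close> has a bound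
    \<open>D\<close>, which makes the pointwise Picard bound a summable sequence times
    \<open>k\<close>.\<close>
  have bounds: "\<exists>b. summable b \<and> (\<forall>n. 0 \<le> b n) \<and> (\<forall>n. \<forall>x\<in>{s..t}. \<bar>f n x\<bar> \<le> b n * k x)"
    if f: "\<And>n x. \<bar>f n x\<bar> \<le> k x * (C * (\<bar>?K x\<bar> ^ n / fact n))" for f :: "nat \<Rightarrow> real \<Rightarrow> real" and s t
  proof -
    have "compact (?K ` {s..t})"
      using ac_derivative_continuous[OF ac_derivative_primitive[OF k]]
      by (intro compact_continuous_image) (auto elim: continuous_on_subset)
    from compact_imp_bounded[OF this] obtain D where D: "\<And>x. x \<in> {s..t} \<Longrightarrow> \<bar>?K x\<bar> \<le> D"
      by (force simp: bounded_iff)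
    have "\<bar>f n x\<bar> \<le> (C * (\<bar>D\<bar> ^ n / fact n)) * k x" if "x \<in> {s..t}" for n x
    proof -
      have "\<bar>?K x\<bar> ^ n \<le> \<bar>D\<bar> ^ n" using D[OF that] by (intro power_mono) auto
      then have "k x * (C * (\<bar>?K x\<bar> ^ n / fact n)) \<le> k x * (C * (\<bar>D\<bar> ^ n / fact n))"
        by (intro mult_left_mono divide_right_mono) (auto simp: C_def k_def)
      then show ?thesis using f[of n x] by (simp add: mult.commute)
    qed
    moreover have "summable (\<lambda>n. C * (\<bar>D\<bar> ^ n / fact n))" by (rule summable_scaled_exp)
    moreover have "0 \<le> C * (\<bar>D\<bar> ^ n / fact n)" for n by (simp add: C_def)
    ultimately show ?thesis by blast
  qed
  have B0: "0 \<le> C * (\<bar>?K x\<bar> ^ n / fact n)" for x n by (simp add: C_def)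
  have fV: "\<bar>V n x\<bar> \<le> k x * (C * (\<bar>?K x\<bar> ^ n / fact n))" for n x
    using bV[of n x] mult_right_mono[OF _ B0[of x n], of 1 "k x"] by (simp add: k_def)
  have fU: "\<bar>W x * U n x\<bar> \<le> k x * (C * (\<bar>?K x\<bar> ^ n / fact n))" for n x
    unfolding abs_mult using bU[of n x] B0[of x n] by (intro mult_mono) (auto simp: k_def)
  have dU: "ac_derivative (\<lambda>x. \<Sum>n. U (Suc n) x) (\<lambda>x. \<Sum>n. V n x)"
    by (rule ac_derivative_suminf[OF _ k bounds[OF fV]])
      (simp_all add: S(1) ac_derivative_primitive locally_integrable_continuous cV
        sU[THEN summable_Suc_iff[THEN iffD2], unfolded S])
  have dV: "ac_derivative (\<lambda>x. \<Sum>n. V (Suc n) x) (\<lambda>x. \<Sum>n. W x * U n x)"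
    by (rule ac_derivative_suminf[OF _ k bounds[OF fU]])
      (simp_all add: S(2) ac_derivative_primitive locally_integrable_mult_continuous[OF W] cU
        sV[THEN summable_Suc_iff[THEN iffD2], unfolded S])
  \<comment> \<open>The zeroth terms are constants with derivative 0. Thus the derivative of the
    full series is that of its tail, and the index shift reproduces the differential
    equation.\<close>
  have eU: "(\<Sum>n. U n x) = \<alpha> + (\<Sum>n. U (Suc n) x)" and eV: "(\<Sum>n. V n x) = \<beta> + (\<Sum>n. V (Suc n) x)" for x
    using suminf_split_head[OF sU, of x] suminf_split_head[OF sV, of x] by (simp_all add: U_def V_def)
  have "ac_derivative (\<lambda>x. \<Sum>n. U n x) (\<lambda>x. \<Sum>n. V n x)"
    using ac_derivative_add[OF ac_derivative_const[of \<alpha>] dU] by (subst eU) simp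
  moreover have "ac_derivative (\<lambda>x. \<Sum>n. V n x) (\<lambda>x. W x * (\<Sum>n. U n x))"
    using ac_derivative_add[OF ac_derivative_const[of \<beta>] dV] by (subst eV) (simp add: suminf_mult sU)
  moreover have "(\<Sum>n. U n 0) = \<alpha>" "(\<Sum>n. V n 0) = \<beta>"
    unfolding eU eV by (simp_all add: S)
  ultimately show ?thesis unfolding schroedinger_solution_def by blast
qed

lemma schroedinger_solution_shift:
  "schroedinger_solution W u v \<Longrightarrow>
    schroedinger_solution (\<lambda>x. W (x + r)) (\<lambda>x. u (x + r)) (\<lambda>x. v (x + r))"
  unfolding schroedinger_solution_def
  using ac_derivative_shift[of u v r] ac_derivative_shift[of v "\<lambda>x. W x * u x" r] by simp

lemma locally_integrable_shift: "locally_integrable f \<Longrightarrow> locally_integrable (\<lambda>x. f (x + r))"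
  by (rule ac_derivative_locally_integrable[OF ac_derivative_shift[OF ac_derivative_primitive]])

lemma schroedinger_solution_exists:
  assumes W: "locally_integrable W"
  shows "\<exists>u v. schroedinger_solution W u v \<and> u s = \<alpha> \<and> v s = \<beta>"
proof -
  obtain u v where uv: "schroedinger_solution (\<lambda>x. W (x + s)) u v" "u 0 = \<alpha>" "v 0 = \<beta>"
    using schroedinger_solution_exists_0[OF locally_integrable_shift[OF W]] by blast
  from schroedinger_solution_shift[OF this(1), of "- s"]
  have "schroedinger_solution W (\<lambda>x. u (x + - s)) (\<lambda>x. v (x + - s))" by simp
  with uv(2,3) show ?thesis by force
qed

lemma schroedinger_solution_combination:
  assumes "schroedinger_solution W u v" "schroedinger_solution W u' v'"
  shows "schroedinger_solution W (\<lambda>x. \<alpha> * u x + \<beta> * u' x) (\<lambda>x. \<alpha> * v x + \<beta> * v' x)"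
proof -
  have "(\<lambda>x. W x * (\<alpha> * u x + \<beta> * u' x)) = (\<lambda>x. \<alpha> * (W x * u x) + \<beta> * (W x * u' x))"
    by (simp add: algebra_simps)
  then show ?thesis
    using assms unfolding schroedinger_solution_def
    by (auto intro!: ac_derivative_add ac_derivative_cmult)
qed

text \<open>The Wronskian has derivative \<open>(W' x - W x) * (u x * u' x)\<close>. Admitting two
  potentials that agree only on \<open>{s..t}\<close> is what makes transfer matrices local.\<close>

lemma wronskian_eq:
  assumes 1: "schroedinger_solution W u v" and 2: "schroedinger_solution W' u' v'"
    and st: "s \<le> t" and eq: "AE x in lborel. x \<in> {s..t} \<longrightarrow> W x = W' x"
  shows "u t * v' t - v t * u' t = u s * v' s - v s * u' s"
proof -
  have d: "ac_derivative u v" "ac_derivative v (\<lambda>x. W x * u x)"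
    "ac_derivative u' v'" "ac_derivative v' (\<lambda>x. W' x * u' x)"
    using 1 2 by (simp_all add: schroedinger_solution_def)
  have "ac_derivative (\<lambda>x. u x * v' x - v x * u' x)
     (\<lambda>x. v x * v' x + u x * (W' x * u' x) - ((W x * u x) * u' x + v x * v' x))"
    by (intro ac_derivative_diff ac_derivative_mult d)
  moreover have "AE x in lborel. x \<in> {s..t} \<longrightarrow>
      v x * v' x + u x * (W' x * u' x) - ((W x * u x) * u' x + v x * v' x) = 0"
    using eq by eventually_elim auto
  ultimately show ?thesis by (rule ac_derivative_zero_imp_eq[OF _ st])
qed

section \<open>Transfer matrices\<close>

definition mat2 :: "real \<Rightarrow> real \<Rightarrow> real \<Rightarrow> real \<Rightarrow> real^2^2" where
  "mat2 a b c d = vector [vector [a, b], vector [c, d]]"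

lemma mat2_nth [simp]:
  "mat2 a b c d $ 1 $ 1 = a" "mat2 a b c d $ 1 $ 2 = b"
  "mat2 a b c d $ 2 $ 1 = c" "mat2 a b c d $ 2 $ 2 = d"
  by (simp_all add: mat2_def)

lemma mat2_eq_iff:
  "M = N \<longleftrightarrow> M$1$1 = N$1$1 \<and> M$1$2 = N$1$2 \<and> M$2$1 = N$2$1 \<and> M$2$2 = N$2$2" for M N :: "real^2^2"
  by (auto simp: vec_eq_iff forall_2)

lemma mult_nth2:
  "((M :: real^2^2) ** N) $ i $ j = M$i$1 * N$1$j + M$i$2 * N$2$j"
  by (simp add: matrix_matrix_mult_def sum_2)

text \<open>The propagator of (u, u') from \<open>s\<close> to \<open>t\<close>, as a relation: for
  each locally integrable \<open>W\<close> its existence and uniqueness are separate lemmas.\<close>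

definition transfers :: "(real \<Rightarrow> real) \<Rightarrow> real \<Rightarrow> real \<Rightarrow> real^2^2 \<Rightarrow> bool" where
  "transfers W s t M \<longleftrightarrow> (\<forall>u v. schroedinger_solution W u v \<longrightarrow>
     u t = M$1$1 * u s + M$1$2 * v s \<and> v t = M$2$1 * u s + M$2$2 * v s)"

text \<open>The Wronskians of a solution for \<open>W'\<close> with the two basis solutions for
  \<open>W\<close> are conserved on \<open>{s..t}\<close>. Their values at \<open>s\<close> are the
  initial data up to sign, and Cramer's rule recovers the solution at \<open>t\<close>.\<close>

lemma transfers_fundamental:
  assumes e1: "schroedinger_solution W e1 d1" "e1 s = 1" "d1 s = 0"
    and e2: "schroedinger_solution W e2 d2" "e2 s = 0" "d2 s = 1"
    and st: "s \<le> t" and eq: "AE x in lborel. x \<in> {s..t} \<longrightarrow> W' x = W x"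
  shows "transfers W' s t (mat2 (e1 t) (e2 t) (d1 t) (d2 t))" "e1 t * d2 t - e2 t * d1 t = 1"
proof -
  show det: "e1 t * d2 t - e2 t * d1 t = 1"
    using wronskian_eq[OF e1(1) e2(1) st] e1(2,3) e2(2,3) by (simp add: mult.commute)
  show "transfers W' s t (mat2 (e1 t) (e2 t) (d1 t) (d2 t))"
    unfolding transfers_def
  proof (intro allI impI)
    fix u v assume uv: "schroedinger_solution W' u v"
    have 1: "u t * d1 t - v t * e1 t = - v s" and 2: "u t * d2 t - v t * e2 t = u s"
      using wronskian_eq[OF uv e1(1) st eq] wronskian_eq[OF uv e2(1) st eq] e1(2,3) e2(2,3) by simp_all
    have "u t = u t * (e1 t * d2 t - e2 t * d1 t)" "v t = v t * (e1 t * d2 t - e2 t * d1 t)"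
      using det by simp_all
    then have "u t = e1 t * u s + e2 t * v s" "v t = d1 t * u s + d2 t * v s"
      using 1 2 by algebra+
    then show "u t = mat2 (e1 t) (e2 t) (d1 t) (d2 t) $ 1 $ 1 * u s + mat2 (e1 t) (e2 t) (d1 t) (d2 t) $ 1 $ 2 * v s \<and>
         v t = mat2 (e1 t) (e2 t) (d1 t) (d2 t) $ 2 $ 1 * u s + mat2 (e1 t) (e2 t) (d1 t) (d2 t) $ 2 $ 2 * v s"
      by simp
  qed
qed

lemma transfers_exists:
  assumes W: "locally_integrable W" and st: "s \<le> t"
  shows "\<exists>M. transfers W s t M"
proof -
  obtain e1 d1 e2 d2 where "schroedinger_solution W e1 d1" "e1 s = 1" "d1 s = 0"
    "schroedinger_solution W e2 d2" "e2 s = 0" "d2 s = 1"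
    using schroedinger_solution_exists[OF W] by metis
  from transfers_fundamental(1)[OF this st, of W] show ?thesis by auto
qed

text \<open>Through this locality a letter inside a word, and the unchanged part of a modified
  letter, enter with matrices computed from the letter alone.\<close>

lemma transfers_cong_AE:
  assumes M: "transfers W s t M" and W: "locally_integrable W" and st: "s \<le> t"
    and eq: "AE x in lborel. x \<in> {s..t} \<longrightarrow> W' x = W x"
  shows "transfers W' s t M"
proof -
  obtain e1 d1 e2 d2 where e: "schroedinger_solution W e1 d1" "e1 s = 1" "d1 s = 0"
    "schroedinger_solution W e2 d2" "e2 s = 0" "d2 s = 1"
    using schroedinger_solution_exists[OF W] by metis
  have "M = mat2 (e1 t) (e2 t) (d1 t) (d2 t)"
    using M e unfolding transfers_def mat2_eq_iff by force
  with transfers_fundamental(1)[OF e st eq] show ?thesis by simp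
qed

lemma transfers_det:
  assumes M: "transfers W s t M" and W: "locally_integrable W" and st: "s \<le> t"
  shows "det M = 1"
proof -
  obtain e1 d1 e2 d2 where e: "schroedinger_solution W e1 d1" "e1 s = 1" "d1 s = 0"
    "schroedinger_solution W e2 d2" "e2 s = 0" "d2 s = 1"
    using schroedinger_solution_exists[OF W] by metis
  have "M = mat2 (e1 t) (e2 t) (d1 t) (d2 t)"
    using M e unfolding transfers_def mat2_eq_iff by force
  with transfers_fundamental(2)[OF e st, of W] show ?thesis by (simp add: det_2)
qed

lemma transfers_unique:
  assumes "transfers W s t M" "transfers W s t N" and W: "locally_integrable W"
  shows "M = N"
proof -
  obtain e1 d1 e2 d2 where e: "schroedinger_solution W e1 d1" "e1 s = 1" "d1 s = 0"
    "schroedinger_solution W e2 d2" "e2 s = 0" "d2 s = 1"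
    using schroedinger_solution_exists[OF W] by metis
  have "M = mat2 (e1 t) (e2 t) (d1 t) (d2 t)" "N = mat2 (e1 t) (e2 t) (d1 t) (d2 t)"
    using assms e unfolding transfers_def mat2_eq_iff by force+
  then show ?thesis by simp
qed

lemma transfers_comp:
  assumes "transfers W s t M" "transfers W t r N"
  shows "transfers W s r (N ** M)"
  unfolding transfers_def
proof (intro allI impI)
  fix u v assume "schroedinger_solution W u v"
  with assms have "u t = M$1$1 * u s + M$1$2 * v s" "v t = M$2$1 * u s + M$2$2 * v s"
    "u r = N$1$1 * u t + N$1$2 * v t" "v r = N$2$1 * u t + N$2$2 * v t"
    by (auto simp: transfers_def)
  then show "u r = (N ** M)$1$1 * u s + (N ** M)$1$2 * v s \<and> v r = (N ** M)$2$1 * u s + (N ** M)$2$2 * v s"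
    by (simp add: mult_nth2 algebra_simps)
qed

lemma transfers_shift:
  assumes "transfers (\<lambda>x. W (x + r)) s t M"
  shows "transfers W (s + r) (t + r) M"
  using assms schroedinger_solution_shift[of W _ _ r] unfolding transfers_def by blast

lemma transfers_zero:
  assumes "s \<le> t" "AE x in lborel. x \<in> {s..t} \<longrightarrow> W x = 0"
  shows "transfers W s t (mat2 1 (t - s) 0 1)"
proof -
  have "schroedinger_solution (\<lambda>_. 0) (\<lambda>_. 1) (\<lambda>_. 0)"
    by (auto simp: schroedinger_solution_def intro!: ac_derivative_const)
  moreover have "schroedinger_solution (\<lambda>_. 0) (\<lambda>x. x - s) (\<lambda>_. 1)"
    by (auto simp: schroedinger_solution_def intro!: ac_derivative_const ac_derivative_has_derivative derivative_eq_intros)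
  ultimately show ?thesis
    using transfers_fundamental(1)[of "\<lambda>_. 0" "\<lambda>_. 1" "\<lambda>_. 0" s "\<lambda>x. x - s" "\<lambda>_. 1" t W] assms by simp
qed

lemma transfers_one:
  assumes "s \<le> t" "AE x in lborel. x \<in> {s..t} \<longrightarrow> W x = 1"
  shows "transfers W s t (mat2 (cosh (t - s)) (sinh (t - s)) (sinh (t - s)) (cosh (t - s)))"
proof -
  have c: "ac_derivative (\<lambda>x. cosh (x - s)) (\<lambda>x. sinh (x - s))"
    by (intro ac_derivative_has_derivative) (auto intro!: derivative_eq_intros continuous_intros)
  have d: "ac_derivative (\<lambda>x. sinh (x - s)) (\<lambda>x. cosh (x - s))"
    by (intro ac_derivative_has_derivative) (auto intro!: derivative_eq_intros continuous_intros)
  show ?thesis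
    using transfers_fundamental(1)[of "\<lambda>_. 1" "\<lambda>x. cosh (x - s)" "\<lambda>x. sinh (x - s)" s
        "\<lambda>x. sinh (x - s)" "\<lambda>x. cosh (x - s)" t W] assms c d
    by (simp add: schroedinger_solution_def)
qed

section \<open>Semigroups of unimodular matrices with bounded traces\<close>

text \<open>The adjugate: it inverts unimodular matrices and is linear in the entries, hence
  continuous, so it passes to limits.\<close>

definition adj2 :: "real^2^2 \<Rightarrow> real^2^2" where
  "adj2 M = mat2 (M$2$2) (- M$1$2) (- M$2$1) (M$1$1)"

lemma trace2: "trace (M :: real^2^2) = M$1$1 + M$2$2"
  by (simp add: trace_def sum_2)

lemma mat_1_nth2 [simp]:
  "(mat 1 :: real^2^2)$1$1 = 1" "(mat 1 :: real^2^2)$1$2 = 0"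
  "(mat 1 :: real^2^2)$2$1 = 0" "(mat 1 :: real^2^2)$2$2 = 1"
  by (simp_all add: mat_def)

lemma adj2_mult: "det M = 1 \<Longrightarrow> adj2 M ** M = mat 1" "det M = 1 \<Longrightarrow> M ** adj2 M = mat 1"
  by (simp_all add: mat2_eq_iff mult_nth2 adj2_def det_2 algebra_simps)

lemma tendsto_entries2:
  "(f \<longlongrightarrow> (M :: real^2^2)) F \<longleftrightarrow> (\<forall>i j. ((\<lambda>x. f x $ i $ j) \<longlongrightarrow> M $ i $ j) F)"
  by (auto intro: tendsto_vec_nth vec_tendstoI)

lemma tendsto_mult2:
  fixes M N :: "real^2^2"
  assumes "(f \<longlongrightarrow> M) F" "(g \<longlongrightarrow> N) F"
  shows "((\<lambda>x. f x ** g x) \<longlongrightarrow> M ** N) F"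
  unfolding tendsto_entries2[of "\<lambda>x. f x ** g x"] mult_nth2
  by (auto intro!: tendsto_intros assms)

lemma tendsto_adj2:
  assumes "(f \<longlongrightarrow> M) F" shows "((\<lambda>x. adj2 (f x)) \<longlongrightarrow> adj2 M) F"
  unfolding tendsto_entries2[of "\<lambda>x. adj2 (f x)"] unfolding adj2_def
  by (auto simp: forall_2 intro!: tendsto_intros assms)

lemma norm_le_entries2:
  "norm (M :: real^2^2) \<le> \<bar>M$1$1\<bar> + \<bar>M$1$2\<bar> + \<bar>M$2$1\<bar> + \<bar>M$2$2\<bar>"
proof -
  have "norm M \<le> (\<Sum>i\<in>UNIV. norm (M$i))"
    unfolding norm_vec_def[of M] by (rule L2_set_le_sum) auto
  then have "norm M \<le> norm (M$1) + norm (M$2)" by (simp add: sum_2)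
  then show ?thesis
    using norm_le_l1_cart[of "M$1"] norm_le_l1_cart[of "M$2"] by (simp add: sum_2)
qed

text \<open>Trace zero \<open>2 \<times> 2\<close> matrices form a Lorentzian space under the determinant, and this is the
  equality case of the reverse Cauchy-Schwarz inequality for two timelike or null vectors.\<close>

lemma reverse_Cauchy_Schwarz:
  fixes p q r p' q' r' :: real
  assumes 1: "p\<^sup>2 + q * r \<le> 0" and 2: "p'\<^sup>2 + q' * r' \<le> 0"
    and 3: "0 \<le> - (q * r' - q' * r)\<^sup>2 - 4 * ((p * q' - q * p') * (r * p' - p * r'))"
  shows "q * r' = q' * r \<and> p * q' = q * p' \<and> r * p' = p * r'"
proof (cases "q = 0 \<or> q' = 0")
  \<comment> \<open>A trace-free matrix with a zero off the diagonal and nonnegative determinant has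
    zero diagonal, so it is nilpotent.\<close>
  case True
  then show ?thesis
  proof
    assume q: "q = 0"
    then have p: "p = 0" using 1 by simp
    then have "q' * r = 0" using 3 q by simp
    then show ?thesis using p q 2 by auto
  next
    assume q: "q' = 0"
    then have p: "p' = 0" using 2 by simp
    then have "q * r' = 0" using 3 q by simp
    then show ?thesis using p q 1 by auto
  qed
next
  case False
  then have q: "q \<noteq> 0" and q': "q' \<noteq> 0" by auto
  \<comment> \<open>The eigenvectors of the trace-free matrix with rows (p, q) and (r, -p) have
    slopes -s +- i sqrt m, so (s, m) locates a point of the closed upper half plane. In these
    coordinates the expression in the third hypothesis is minus a sum of nonnegative terms, which
    vanishes only if the two points coincide.\<close>
  define s m s' m' where "s = p / q" and "m = - (r / q + s\<^sup>2)" and "s' = p' / q'" and "m' = - (r' / q' + s'\<^sup>2)"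
  have p: "p = s * q" "r = - (s\<^sup>2 + m) * q" and p': "p' = s' * q'" "r' = - (s'\<^sup>2 + m') * q'"
    using q q' by (simp_all add: s_def m_def s'_def m'_def field_simps)
  have "q\<^sup>2 * m = - (p\<^sup>2 + q * r)" "q'\<^sup>2 * m' = - (p'\<^sup>2 + q' * r')"
    unfolding p p' by algebra+
  then have m: "0 \<le> m" "0 \<le> m'"
    using 1 2 q q' by (metis zero_le_mult_iff zero_less_power2 neg_0_le_iff_le linorder_not_less)+
  have "- (q * r' - q' * r)\<^sup>2 - 4 * ((p * q' - q * p') * (r * p' - p * r')) =
      - (q * q')\<^sup>2 * ((s - s')^4 + 2 * (s - s')\<^sup>2 * (m + m') + (m - m')\<^sup>2)"
    unfolding p p' by algebra
  with 3 have "(q * q')\<^sup>2 * ((s - s')^4 + 2 * (s - s')\<^sup>2 * (m + m') + (m - m')\<^sup>2) \<le> 0" by simp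
  moreover have "0 < (q * q')\<^sup>2" using q q' by simp
  ultimately have "(s - s')^4 + 2 * (s - s')\<^sup>2 * (m + m') + (m - m')\<^sup>2 \<le> 0"
    by (simp add: mult_le_0_iff)
  moreover have "0 \<le> (s - s')^4" "0 \<le> 2 * (s - s')\<^sup>2 * (m + m')" "0 \<le> (m - m')\<^sup>2"
    using m by simp_all
  ultimately have "(s - s')^4 = 0" "(m - m')\<^sup>2 = 0" by linarith+
  then have "s = s'" "m = m'" by simp_all
  then show ?thesis unfolding p p' by simp
qed

text \<open>Commutators see only the trace-free parts of \<open>A\<close> and \<open>B\<close>, and
  the trace bounds say that these parts have nonnegative determinant. The commutator bound says that
  \<open>det (A ** B - B ** A)\<close> is nonnegative.\<close>

lemma commute_if_commutator_trace_le:
  fixes A B :: "real^2^2"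
  assumes A: "det A = 1" "\<bar>trace A\<bar> \<le> 2" and B: "det B = 1" "\<bar>trace B\<bar> \<le> 2"
    and tr: "trace (adj2 A ** adj2 B ** (A ** B)) \<le> 2"
  shows "A ** B = B ** A"
proof -
  define p where "p M = (M$1$1 - M$2$2) / 2" for M :: "real^2^2"
  have sq: "(p M)\<^sup>2 + M$1$2 * M$2$1 = (trace M)\<^sup>2 / 4 - det M" for M :: "real^2^2"
    by (simp add: p_def trace2 det_2 power2_eq_square field_simps)
  have tr4: "(trace M)\<^sup>2 / 4 \<le> 1" if "\<bar>trace M\<bar> \<le> 2" for M :: "real^2^2"
    using abs_le_square_iff[of "trace M" 2] that by simp
  have 1: "(p A)\<^sup>2 + A$1$2 * A$2$1 \<le> 0" and 2: "(p B)\<^sup>2 + B$1$2 * B$2$1 \<le> 0"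
    using sq[of A] sq[of B] A B tr4 by simp_all
  \<comment> \<open>Both sides are \<open>det (A ** B - B ** A)\<close>: on the left expanded by
    means of the adjugate of \<open>B ** A\<close>, on the right written out in entries.\<close>
  have "2 * (det A * det B) - trace (adj2 A ** adj2 B ** (A ** B)) =
      - (A$1$2 * B$2$1 - B$1$2 * A$2$1)\<^sup>2
      - 4 * ((p A * B$1$2 - A$1$2 * p B) * (A$2$1 * p B - p A * B$2$1))"
  proof -
    have "A$1$1 = A$2$2 + 2 * p A" "B$1$1 = B$2$2 + 2 * p B" by (simp_all add: p_def field_simps)
    then show ?thesis unfolding trace2 det_2 mult_nth2 adj2_def mat2_nth by algebra
  qed
  with tr A B have 3: "0 \<le> - (A$1$2 * B$2$1 - B$1$2 * A$2$1)\<^sup>2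
      - 4 * ((p A * B$1$2 - A$1$2 * p B) * (A$2$1 * p B - p A * B$2$1))"
    by simp
  from reverse_Cauchy_Schwarz[OF 1 2 3] show ?thesis
    unfolding mat2_eq_iff mult_nth2 p_def by (simp add: field_simps)
qed

section \<open>Recurrence of powers and bounded semigroups\<close>

primrec mpow :: "real^2^2 \<Rightarrow> nat \<Rightarrow> real^2^2" where
  "mpow A 0 = mat 1"
| "mpow A (Suc n) = A ** mpow A n"

lemma mpow_add: "mpow A (m + n) = mpow A m ** mpow A n"
  by (induction m) (simp_all add: matrix_mul_assoc)

lemma det_mpow: "det A = 1 \<Longrightarrow> det (mpow A n) = 1"
  by (induction n) (simp_all add: det_mul)

text \<open>The quotients of nearby powers return close to the identity.\<close>

lemma adj2_in_closure:
  assumes G: "bounded G" and mult: "\<And>A B. A \<in> G \<Longrightarrow> B \<in> G \<Longrightarrow> A ** B \<in> G"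
    and A: "A \<in> G" "det A = 1"
  shows "adj2 A \<in> closure G"
proof -
  have pow: "mpow A (Suc n) \<in> G" for n
    by (induction n) (use A mult in \<open>auto simp del: mpow.simps(2) simp: mpow.simps(2)[of A "Suc _"]\<close>, simp)
  have "seq_compact (closure G)"
    using G by (simp add: compact_eq_seq_compact_metric[symmetric])
  moreover have "\<forall>n. mpow A (Suc n) \<in> closure G"
    using pow closure_subset by blast
  ultimately obtain l r where r: "strict_mono r" and l: "((\<lambda>n. mpow A (Suc n)) \<circ> r) \<longlonglongrightarrow> l"
    by (rule seq_compactE)
  let ?Q = "\<lambda>k. mpow A (Suc (r k))"
  have l1: "?Q \<longlonglongrightarrow> l" using l by (simp add: o_def)
  \<comment> \<open>A shift by two makes the exponents differ by at least 2. After the quotient is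
    multiplied by the inverse of \<open>A\<close>, a power with positive exponent remains, which
    lies in \<open>G\<close>; the identity might not.\<close>
  then have l2: "(\<lambda>k. ?Q (k + 2)) \<longlonglongrightarrow> l" by (rule LIMSEQ_ignore_initial_segment)
  have "(\<lambda>k. det (?Q k)) \<longlonglongrightarrow> det l"
    unfolding det_2 by (intro tendsto_intros l1)
  then have "det l = 1"
    unfolding det_mpow[OF A(2)] by (simp add: LIMSEQ_const_iff)
  have "(\<lambda>k. adj2 A ** (adj2 (?Q k) ** ?Q (k + 2))) \<longlonglongrightarrow> adj2 A ** (adj2 l ** l)"
    by (intro tendsto_mult2 tendsto_adj2 tendsto_const l1 l2)
  then have lim: "(\<lambda>k. adj2 A ** (adj2 (?Q k) ** ?Q (k + 2))) \<longlonglongrightarrow> adj2 A"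
    by (simp add: adj2_mult \<open>det l = 1\<close>)
  have mem: "adj2 A ** (adj2 (?Q k) ** ?Q (k + 2)) \<in> closure G" for k
  proof -
    have "r k < r (k + 1)" "r (k + 1) < r (k + 2)" using r by (simp_all add: strict_mono_less)
    then obtain d where d: "r (k + 2) = r k + (Suc 0 + Suc d)"
      using less_imp_Suc_add[of "Suc (r k)" "r (k + 2)"] by auto
    have "?Q (k + 2) = mpow A (Suc (r k) + Suc (Suc d))" using d by simp
    also have "\<dots> = ?Q k ** (A ** mpow A (Suc d))"
      by (simp only: mpow_add mpow.simps(2)[of A "Suc d"])
    finally have "adj2 A ** (adj2 (?Q k) ** ?Q (k + 2)) =
        (adj2 A ** ((adj2 (?Q k) ** ?Q k) ** A)) ** mpow A (Suc d)"
      by (simp only: matrix_mul_assoc)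
    also have "\<dots> = mpow A (Suc d)"
      by (simp only: adj2_mult(1)[OF det_mpow[OF A(2)]] adj2_mult(1)[OF A(2)] matrix_mul_lid)
    finally show ?thesis using pow[of d] closure_subset by auto
  qed
  show ?thesis
    by (rule closed_sequentially[OF closed_closure _ lim]) (use mem in blast)
qed

text \<open>Both inverses are limits of elements of \<open>G\<close>, so the commutator is a limit
  of elements of \<open>G\<close> too and inherits their trace bound.\<close>

lemma commute_if_bounded_traces:
  fixes A B :: "real^2^2"
  assumes G: "bounded G" and mult: "\<And>A B. A \<in> G \<Longrightarrow> B \<in> G \<Longrightarrow> A ** B \<in> G"
    and det: "\<And>A. A \<in> G \<Longrightarrow> det A = 1" and tr: "\<And>A. A \<in> G \<Longrightarrow> \<bar>trace A\<bar> \<le> 2"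
    and A: "A \<in> G" and B: "B \<in> G"
  shows "A ** B = B ** A"
proof (rule commute_if_commutator_trace_le)
  obtain a b where a: "\<And>n. a n \<in> G" "a \<longlonglongrightarrow> adj2 A" and b: "\<And>n. b n \<in> G" "b \<longlonglongrightarrow> adj2 B"
    using adj2_in_closure[OF G mult A det[OF A]] adj2_in_closure[OF G mult B det[OF B]]
    unfolding closure_sequential by blast
  have "(\<lambda>n. a n ** b n ** (A ** B)) \<longlonglongrightarrow> adj2 A ** adj2 B ** (A ** B)"
    by (intro tendsto_mult2 tendsto_const a b)
  then have "(\<lambda>n. trace (a n ** b n ** (A ** B))) \<longlonglongrightarrow> trace (adj2 A ** adj2 B ** (A ** B))"
    unfolding trace2 by (intro tendsto_intros) auto
  moreover have "trace (a n ** b n ** (A ** B)) \<le> 2" for n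
    using tr[of "a n ** b n ** (A ** B)"] mult a b A B by fastforce
  ultimately show "trace (adj2 A ** adj2 B ** (A ** B)) \<le> 2"
    by (intro LIMSEQ_le_const2) auto
qed (use det tr A B in auto)

section \<open>Two-step products and the trace form\<close>

text \<open>The function \<open>x * cosh x - sinh x\<close> vanishes at 0 and has derivative
  \<open>x * sinh x\<close>. Its positivity for every \<open>h > 0\<close> keeps the four two-step
  products linearly independent: it is a factor in the denominator of \<open>D1\<close>
  below.\<close>

lemma sinh_less_cosh_mult:
  fixes h :: real assumes "0 < h" shows "sinh h < h * cosh h"
proof -
  have "(\<lambda>x. x * cosh x - sinh x) 0 < (\<lambda>x. x * cosh x - sinh x) h"
  proof (rule DERIV_pos_imp_increasing_open[OF assms])
    fix x :: real assume "0 < x" "x < h"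
    then have "((\<lambda>x. x * cosh x - sinh x) has_real_derivative x * sinh x) (at x) \<and> 0 < x * sinh x"
      by (auto intro!: derivative_eq_intros)
    then show "\<exists>y. ((\<lambda>x. x * cosh x - sinh x) has_real_derivative y) (at x) \<and> 0 < y" by blast
  qed (auto intro!: continuous_intros)
  then show ?thesis by simp
qed

text \<open>The transfer matrices of length \<open>h\<close> for the constants \<open>0\<close> and \<open>1\<close>; their four products of
  length two form a basis of the \<open>2 \<times> 2\<close> matrices.\<close>

definition free_step :: "real \<Rightarrow> real^2^2" where
  "free_step h = mat2 1 h 0 1"

definition cosh_step :: "real \<Rightarrow> real^2^2" where
  "cosh_step h = mat2 (cosh h) (sinh h) (sinh h) (cosh h)"

text \<open>Pairing with a basis under the trace form determines \<open>X\<close>. The free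
  parameter \<open>\<delta>\<close> allows two uses: 0 gives nondegeneracy, and 2 turns bounded
  traces into bounded norms.\<close>

lemma entries_bounded_by_traces:
  assumes h: "0 < h"
  shows "\<exists>C. \<forall>X \<delta>. (\<forall>K\<in>{free_step h, cosh_step h}. \<forall>K'\<in>{free_step h, cosh_step h}.
      \<bar>trace (X ** (K ** K'))\<bar> \<le> \<delta>) \<longrightarrow> norm X \<le> C * \<delta>"
proof -
  define c s where "c = cosh h" and "s = sinh h"
  have c: "c * c = 1 + s * s" "0 < c" and s: "0 < s" "0 < h * c - s"
    using h sinh_less_cosh_mult[OF h] cosh_square_eq[of h] by (auto simp: c_def s_def power2_eq_square)
  \<comment> \<open>The constants come from solving the four trace equations explicitly:
    \<open>D1\<close> bounds the sum of the diagonal entries, \<open>D2\<close> their difference,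
    \<open>D3\<close> the lower left entry and \<open>D4\<close> the upper right one.\<close>
  define D1 where "D1 = (1 + 2 * c + c * c) / (s * (h * c - s))"
  define D2 where "D2 = 2 / (h * s)"
  define D3 where "D3 = (1 + D1) / (2 * h)"
  define D4 where "D4 = (1 + D1 * (c * c + s * s)) / (2 * c * s) + D3"
  have "norm X \<le> (D1 + D2 + D3 + D4) * \<delta>"
    if tr: "\<forall>K\<in>{free_step h, cosh_step h}. \<forall>K'\<in>{free_step h, cosh_step h}.
      \<bar>trace (X ** (K ** K'))\<bar> \<le> \<delta>" for X \<delta>
  proof -
    define p q r w where "p = X$1$1" and "q = X$1$2" and "r = X$2$1" and "w = X$2$2"
    define t1 t2 t3 t4 where "t1 = p + w + 2 * h * r"
      and "t2 = (p + w) * (c * c + s * s) + (q + r) * (2 * c * s)"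
      and "t3 = p * (c + h * s) + q * s + r * (s + h * c) + w * c"
      and "t4 = p * c + q * s + r * (c * h + s) + w * (s * h + c)"
    have t: "\<bar>t1\<bar> \<le> \<delta>" "\<bar>t2\<bar> \<le> \<delta>" "\<bar>t3\<bar> \<le> \<delta>" "\<bar>t4\<bar> \<le> \<delta>"
      using tr by (auto simp: t1_def t2_def t3_def t4_def p_def q_def r_def w_def trace2 mult_nth2
          free_step_def cosh_step_def c_def[symmetric] s_def[symmetric] algebra_simps)
    have \<delta>: "0 \<le> \<delta>" using t(1) by linarith
    have "\<bar>p + w\<bar> * (s * (h * c - s)) = \<bar>(p + w) * (s * (s - h * c))\<bar>"
    proof -
      have "\<bar>s * (s - h * c)\<bar> = s * (h * c - s)" using s by (simp add: abs_mult)
      then show ?thesis by (simp only: abs_mult[of "p + w"])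
    qed
    \<comment> \<open>This combination of the four traces eliminates the off-diagonal entries, by
      \<open>c * c = 1 + s * s\<close>.\<close>
    also have "(p + w) * (s * (s - h * c)) = t2 - c * (t3 + t4) + c * c * t1"
      unfolding t1_def t2_def t3_def t4_def using c(1) by algebra
    also have "\<bar>\<dots>\<bar> \<le> \<bar>t2\<bar> + c * (\<bar>t3\<bar> + \<bar>t4\<bar>) + c * c * \<bar>t1\<bar>"
    proof -
      have "\<bar>c * (t3 + t4)\<bar> \<le> c * (\<bar>t3\<bar> + \<bar>t4\<bar>)" using c by (simp add: abs_mult)
      moreover have "\<bar>c * c * t1\<bar> = c * c * \<bar>t1\<bar>" using c by (simp add: abs_mult)
      ultimately show ?thesis by linarith
    qed
    also have "\<dots> \<le> \<delta> + c * (\<delta> + \<delta>) + c * c * \<delta>"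
      using t c(2) by (intro add_mono mult_left_mono) auto
    finally have 1: "\<bar>p + w\<bar> \<le> D1 * \<delta>"
      using s by (simp add: D1_def field_simps)
    have "\<bar>p - w\<bar> * (h * s) = \<bar>(p - w) * (h * s)\<bar>" using s h by (simp add: abs_mult)
    also have "(p - w) * (h * s) = t3 - t4" unfolding t3_def t4_def by algebra
    finally have 2: "\<bar>p - w\<bar> \<le> D2 * \<delta>"
      using t s h by (simp add: D2_def field_simps)
    have "\<bar>r\<bar> * (2 * h) = \<bar>t1 - (p + w)\<bar>" using h by (simp add: t1_def abs_mult)
    then have "\<bar>r\<bar> * (2 * h) \<le> \<delta> + D1 * \<delta>" using 1 t by linarith
    then have 3: "\<bar>r\<bar> \<le> D3 * \<delta>" using h by (simp add: D3_def field_simps)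
    have "\<bar>q + r\<bar> * (2 * c * s) = \<bar>t2 - (p + w) * (c * c + s * s)\<bar>"
      using c s by (simp add: t2_def abs_mult)
    also have "\<dots> \<le> \<bar>t2\<bar> + \<bar>p + w\<bar> * (c * c + s * s)"
      using c(2) s by (intro order_trans[OF abs_triangle_ineq4]) (simp add: abs_mult)
    also have "\<dots> \<le> \<delta> + D1 * \<delta> * (c * c + s * s)"
      using 1 t by (intro add_mono mult_right_mono) auto
    finally have "\<bar>q + r\<bar> \<le> (1 + D1 * (c * c + s * s)) / (2 * c * s) * \<delta>"
      using c(2) s by (simp add: field_simps)
    then have 4: "\<bar>q\<bar> \<le> D4 * \<delta>" using 3 unfolding D4_def distrib_right by linarith
    have "\<bar>p\<bar> + \<bar>w\<bar> \<le> D1 * \<delta> + D2 * \<delta>" using 1 2 by linarith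
    then show ?thesis
      using norm_le_entries2[of X] 3 4 unfolding p_def q_def r_def w_def distrib_right by linarith
  qed
  then show ?thesis by blast
qed

text \<open>The factor \<open>B\<close> stands for everything a block leaves unchanged; being
  invertible, it preserves the spanning property of the four products.\<close>

lemma semigroup_contains_hyperbolic:
  fixes G :: "(real^2^2) set"
  assumes h: "0 < h" and mult: "\<And>A B. A \<in> G \<Longrightarrow> B \<in> G \<Longrightarrow> A ** B \<in> G"
    and det: "\<And>A. A \<in> G \<Longrightarrow> det A = 1" and B: "det B = 1"
    and gen: "\<And>K K'. K \<in> {free_step h, cosh_step h} \<Longrightarrow> K' \<in> {free_step h, cosh_step h} \<Longrightarrow>
      B ** (K ** K') \<in> G"
  shows "\<exists>A\<in>G. 2 < \<bar>trace A\<bar>"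
proof (rule ccontr)
  assume "\<not> ?thesis"
  then have tr: "\<And>A. A \<in> G \<Longrightarrow> \<bar>trace A\<bar> \<le> 2" by force
  let ?S = "{free_step h, cosh_step h}"
  obtain C where C: "\<And>X \<delta>. (\<And>K K'. K \<in> ?S \<Longrightarrow> K' \<in> ?S \<Longrightarrow>
      \<bar>trace (X ** (K ** K'))\<bar> \<le> \<delta>) \<Longrightarrow> norm X \<le> C * \<delta>"
    using entries_bounded_by_traces[OF h] by blast
  \<comment> \<open>The bound with \<open>\<delta> = 0\<close>, carried over to the generators by
    cancelling \<open>B\<close>.\<close>
  have nondeg: "X = 0" if "\<And>K K'. K \<in> ?S \<Longrightarrow> K' \<in> ?S \<Longrightarrow> trace (X ** (B ** (K ** K'))) = 0" for X
  proof -
    have "norm (X ** B) \<le> C * 0"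
      by (rule C) (use that in \<open>simp add: matrix_mul_assoc\<close>)
    then have "X ** B = 0" by simp
    then have "X ** (B ** adj2 B) = 0" by (simp add: matrix_mul_assoc)
    then show "X = 0" by (simp add: adj2_mult B)
  qed
  \<comment> \<open>The trace bounds control \<open>X ** B\<close>; the bounded linear map that
    multiplies by the inverse of \<open>B\<close> brings the estimate back to
    \<open>G\<close>.\<close>
  have "linear (\<lambda>X :: real^2^2. X ** adj2 B)"
    by (rule linearI) (simp_all add: mat2_eq_iff mult_nth2 algebra_simps)
  then have "bounded_linear (\<lambda>X :: real^2^2. X ** adj2 B)" by (simp add: linear_conv_bounded_linear)
  moreover have "bounded ((\<lambda>X. X ** B) ` G)"
    unfolding bounded_iff
  proof (intro exI[of _ "C * 2"] ballI)
    fix Y assume "Y \<in> (\<lambda>X. X ** B) ` G"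
    then obtain X where X: "X \<in> G" "Y = X ** B" by blast
    show "norm Y \<le> C * 2"
    proof (rule C)
      fix K K' assume "K \<in> ?S" "K' \<in> ?S"
      then have "X ** (B ** (K ** K')) \<in> G" using mult X gen by blast
      then show "\<bar>trace (Y ** (K ** K'))\<bar> \<le> 2" using tr X by (simp add: matrix_mul_assoc)
    qed
  qed
  ultimately have "bounded ((\<lambda>X. X ** adj2 B) ` (\<lambda>X. X ** B) ` G)"
    by (rule bounded_linear_image[rotated])
  moreover have "(\<lambda>X. X ** adj2 B) ` (\<lambda>X. X ** B) ` G = G"
    by (simp add: image_image matrix_mul_assoc[symmetric] adj2_mult B)
  ultimately have bd: "bounded G" by simp
  have comm: "M ** N = N ** M" if "M \<in> G" "N \<in> G" for M N
    by (rule commute_if_bounded_traces[OF bd]) (use mult det tr that in auto)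
  \<comment> \<open>Cyclicity of the trace moves the commutator from the pair \<open>N\<close>,
    \<open>M\<close> to the pair \<open>M\<close>, \<open>L\<close>.\<close>
  have shift: "trace ((N ** M - M ** N) ** L) = 0" if "M ** L = L ** M" for N M L :: "real^2^2"
  proof -
    have "trace ((N ** M - M ** N) ** L) = trace (N ** (M ** L - L ** M))"
      by (simp add: trace2 mult_nth2 algebra_simps)
    then show ?thesis by (simp add: that trace2 mult_nth2)
  qed
  \<comment> \<open>An element of \<open>G\<close> commutes with the generators, so its commutator
    with any matrix is orthogonal to them and vanishes. Then the generators are central, and
    repeating the argument makes all matrices commute.\<close>
  have comm1: "N ** M = M ** N" if M: "M \<in> G" for N M
  proof -
    have "N ** M - M ** N = 0"
    proof (rule nondeg)
      fix K K' assume "K \<in> ?S" "K' \<in> ?S"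
      then show "trace ((N ** M - M ** N) ** (B ** (K ** K'))) = 0"
        by (intro shift comm[OF M gen])
    qed
    then show ?thesis by simp
  qed
  have comm2: "N ** M = M ** N" for N M :: "real^2^2"
  proof -
    have "N ** M - M ** N = 0"
    proof (rule nondeg)
      fix K K' assume "K \<in> ?S" "K' \<in> ?S"
      then show "trace ((N ** M - M ** N) ** (B ** (K ** K'))) = 0"
        by (intro shift comm1[OF gen])
    qed
    then show ?thesis by simp
  qed
  from comm2[of "mat2 0 1 0 0" "mat2 0 0 1 0"] show False
    by (simp add: mat2_eq_iff mult_nth2)
qed

section \<open>Elements of \<open>l2\<close> and their representatives\<close>

lemma l2_eq_iff: "u = v \<longleftrightarrow> (AE x in lborel. l2_fun u x = l2_fun v x)"
  using Abs_l2_eq_iff[OF l2_fun(1) l2_fun(1), of u v] by (simp add: l2_fun(2))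

lemma l2_fun_add: "AE x in lborel. l2_fun (u + v) x = l2_fun u x + l2_fun v x"
proof -
  have "Abs_l2 (l2_fun u) + Abs_l2 (l2_fun v) = Abs_l2 (\<lambda>x. l2_fun u x + l2_fun v x)"
    by (rule plus_l2.abs_eq) (simp_all add: l2_fun)
  then show ?thesis
    using l2_fun_Abs[OF square_integrable_add[OF l2_fun(1) l2_fun(1)], of u v] by (simp add: l2_fun(2))
qed

lemma l2_fun_scaleR: "AE x in lborel. l2_fun (r *\<^sub>R u) x = r * l2_fun u x"
proof -
  have "r *\<^sub>R Abs_l2 (l2_fun u) = Abs_l2 (\<lambda>x. r * l2_fun u x)"
    by (rule scaleR_l2.abs_eq) (simp_all add: l2_fun)
  then show ?thesis
    using l2_fun_Abs[OF square_integrable_cmult[OF l2_fun(1)], of r u] by (simp add: l2_fun(2))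
qed

lemma l2_fun_diff: "AE x in lborel. l2_fun (u - v) x = l2_fun u x - l2_fun v x"
proof -
  have "u - v = u + (-1) *\<^sub>R v" by simp
  then show ?thesis
    using l2_fun_add[of u "(-1) *\<^sub>R v"] l2_fun_scaleR[of "-1" v] by auto
qed

lemma l2_fun_zero: "AE x in lborel. l2_fun 0 x = 0"
  using l2_fun_scaleR[of 0 0] by simp

lemma inner_Abs_l2:
  assumes "square_integrable f" "square_integrable g"
  shows "inner (Abs_l2 f) (Abs_l2 g) = (\<integral>x. f x * g x \<partial>lborel)"
  by (rule inner_l2.abs_eq) (simp_all add: assms)

lemma norm_l2_power2: "(norm (u :: l2))\<^sup>2 = (\<integral>x. (l2_fun u x)\<^sup>2 \<partial>lborel)"
  using inner_Abs_l2[OF l2_fun(1) l2_fun(1), of u u]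
  by (simp add: l2_fun(2) power2_norm_eq_inner flip: power2_eq_square)

lemma Cauchy_Schwarz_square_integrable:
  assumes "square_integrable f" "square_integrable g"
  shows "(\<integral>x. f x * g x \<partial>lborel)\<^sup>2 \<le> (\<integral>x. (f x)\<^sup>2 \<partial>lborel) * (\<integral>x. (g x)\<^sup>2 \<partial>lborel)"
  using Cauchy_Schwarz_ineq[of "Abs_l2 f" "Abs_l2 g"] assms
  by (simp add: inner_Abs_l2 power2_eq_square)

section \<open>A Schur test\<close>

lemma integrable_exp_abs:
  assumes k: "0 < (k :: real)"
  shows "integrable lborel (\<lambda>x. exp (- k * \<bar>x\<bar>))"
proof -
  have "(\<integral>\<^sup>+x. ennreal (exp (- k * x)) * indicator {0..} x \<partial>lborel) = ennreal (0 - (- exp (- k * 0) / k))"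
  proof (rule nn_integral_FTC_atLeast)
    have "((\<lambda>x. exp (- k * x)) \<longlongrightarrow> 0) at_top"
      by (rule filterlim_compose[OF exp_at_bot filterlim_tendsto_neg_mult_at_bot[OF tendsto_const _ filterlim_ident]])
        (use k in simp)
    then show "((\<lambda>x. - exp (- k * x) / k) \<longlongrightarrow> 0) at_top"
      by (rule tendsto_eq_rhs[OF tendsto_divide[OF tendsto_minus tendsto_const]]) (use k in auto)
  qed (use k in \<open>auto intro!: derivative_eq_intros\<close>)
  then have "(\<integral>\<^sup>+x. ennreal (indicator {0..} x * exp (- k * x)) \<partial>lborel) < \<infinity>"
    by (simp add: ennreal_mult' ennreal_indicator mult.commute)
  then have 1: "integrable lborel (\<lambda>x. indicator {0..} x * exp (- k * x))"
    by (intro integrableI_nonneg) auto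
  have 2: "integrable lborel (\<lambda>x. indicator {0..} (0 + -1 * x) * exp (- k * (0 + -1 * x)))"
    using lborel_integrable_real_affine[OF 1, of "-1" 0] by simp
  show ?thesis
    by (rule Bochner_Integration.integrable_bound[OF Bochner_Integration.integrable_add[OF 1 2]])
      (auto split: split_indicator)
qed

definition exp_kernel_mass :: "real \<Rightarrow> real" where
  "exp_kernel_mass k = (\<integral>x. exp (- k * \<bar>x\<bar>) \<partial>lborel)"

lemma exp_kernel_integral:
  assumes k: "0 < k"
  shows "integrable lborel (\<lambda>y. exp (- k * \<bar>x - y\<bar>))" "(\<integral>y. exp (- k * \<bar>x - y\<bar>) \<partial>lborel) = exp_kernel_mass k"
    "integrable lborel (\<lambda>x. exp (- k * \<bar>x - y\<bar>))" "(\<integral>x. exp (- k * \<bar>x - y\<bar>) \<partial>lborel) = exp_kernel_mass k"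
proof -
  show "integrable lborel (\<lambda>y. exp (- k * \<bar>x - y\<bar>))"
    using lborel_integrable_real_affine[OF integrable_exp_abs[OF k], of "-1" x] by simp
  show "(\<integral>y. exp (- k * \<bar>x - y\<bar>) \<partial>lborel) = exp_kernel_mass k"
    using lborel_integral_real_affine[of "-1" "\<lambda>x. exp (- k * \<bar>x\<bar>)" x] by (simp add: exp_kernel_mass_def)
  show "integrable lborel (\<lambda>x. exp (- k * \<bar>x - y\<bar>))"
    using lborel_integrable_real_affine[OF integrable_exp_abs[OF k], of 1 "-y"] by simp
  show "(\<integral>x. exp (- k * \<bar>x - y\<bar>) \<partial>lborel) = exp_kernel_mass k"
    using lborel_integral_real_affine[of 1 "\<lambda>x. exp (- k * \<bar>x\<bar>)" "-y"] by (simp add: exp_kernel_mass_def)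
qed

lemma square_integrable_exp_kernel:
  assumes "0 < k"
  shows "square_integrable (\<lambda>y. exp (- k * \<bar>x - y\<bar>))"
proof -
  have "(exp (- k * \<bar>x - y\<bar>))\<^sup>2 = exp (- (2 * k) * \<bar>x - y\<bar>)" for y
    by (simp add: power2_eq_square flip: exp_add)
  then show ?thesis
    using exp_kernel_integral(1)[of "2 * k" x] assms by (simp add: square_integrable_def)
qed

text \<open>Split the kernel into two equal square roots and apply Cauchy-Schwarz in
  \<open>y\<close>, which gives one factor of the kernel mass; integrating in \<open>x\<close> by
  Fubini gives the other.\<close>

lemma Schur_test_exp_kernel:
  assumes k: "0 < k" and v: "square_integrable v" and f: "f \<in> borel_measurable borel"
    and le: "\<And>x. \<bar>f x\<bar> \<le> C * (\<integral>y. exp (- k * \<bar>x - y\<bar>) * \<bar>v y\<bar> \<partial>lborel)"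
  shows "square_integrable f"
    and "(\<integral>x. (f x)\<^sup>2 \<partial>lborel) \<le> (C * exp_kernel_mass k)\<^sup>2 * (\<integral>x. (v x)\<^sup>2 \<partial>lborel)"
proof -
  let ?J = "exp_kernel_mass k"
  let ?e = "\<lambda>x y. exp (- k * \<bar>x - y\<bar>)"
  have [measurable]: "v \<in> borel_measurable borel" and v2: "integrable lborel (\<lambda>y. (v y)\<^sup>2)"
    using v by (simp_all add: square_integrable_def)
  have J: "0 \<le> ?J" by (simp add: exp_kernel_mass_def)
  define g where "g x = (\<integral>y. ?e x y * (v y)\<^sup>2 \<partial>lborel)" for x
  have prod: "integrable (lborel \<Otimes>\<^sub>M lborel) (\<lambda>(y, x). ?e x y * (v y)\<^sup>2)"
  proof (rule lborel_pair.Fubini_integrable)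
    show "integrable lborel (\<lambda>y. \<integral>x. norm (case (y, x) of (y, x) \<Rightarrow> ?e x y * (v y)\<^sup>2) \<partial>lborel)"
      using v2 exp_kernel_integral(4)[OF k] by (simp add: abs_mult)
    show "AE y in lborel. integrable lborel (\<lambda>x. case (y, x) of (y, x) \<Rightarrow> ?e x y * (v y)\<^sup>2)"
      using exp_kernel_integral(3)[OF k] by simp
  qed measurable
  have g: "integrable lborel g"
    using lborel_pair.integrable_snd[OF prod] by (simp add: g_def[abs_def])
  have "(\<integral>x. g x \<partial>lborel) = (\<integral>y. (\<integral>x. ?e x y * (v y)\<^sup>2 \<partial>lborel) \<partial>lborel)"
    unfolding g_def using lborel_pair.Fubini_integral[OF prod] .
  then have Ig: "(\<integral>x. g x \<partial>lborel) = ?J * (\<integral>x. (v x)\<^sup>2 \<partial>lborel)"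
    using exp_kernel_integral(4)[OF k] by simp
  have bound: "(f x)\<^sup>2 \<le> C\<^sup>2 * ?J * g x" for x
  proof -
    let ?h = "\<lambda>y. exp (- (k / 2) * \<bar>x - y\<bar>)"
    have hh: "?h y * ?h y = ?e x y" for y
      by (simp flip: exp_add)
    have 1: "square_integrable ?h"
      using k by (intro square_integrable_exp_kernel) simp
    have 2: "square_integrable (\<lambda>y. ?h y * \<bar>v y\<bar>)"
      unfolding square_integrable_def
    proof
      have "exp (- (k / 2) * \<bar>x - y\<bar>) \<le> 1" for y using k by simp
      then have "(?h y * \<bar>v y\<bar>)\<^sup>2 \<le> (v y)\<^sup>2" for y
        unfolding power_mult_distrib power2_abs by (intro mult_left_le_one_le) (auto simp: power_le_one)
      then show "integrable lborel (\<lambda>y. (?h y * \<bar>v y\<bar>)\<^sup>2)"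
        by (intro Bochner_Integration.integrable_bound[OF v2]) auto
    qed measurable
    have "\<bar>f x\<bar> \<le> \<bar>C * (\<integral>y. ?e x y * \<bar>v y\<bar> \<partial>lborel)\<bar>" using le[of x] by linarith
    then have "(f x)\<^sup>2 \<le> (C * (\<integral>y. ?e x y * \<bar>v y\<bar> \<partial>lborel))\<^sup>2"
      by (simp only: abs_le_square_iff)
    also have "(\<integral>y. ?e x y * \<bar>v y\<bar> \<partial>lborel) = (\<integral>y. ?h y * (?h y * \<bar>v y\<bar>) \<partial>lborel)"
      by (simp only: mult.assoc[symmetric] hh)
    also have "(C * (\<integral>y. ?h y * (?h y * \<bar>v y\<bar>) \<partial>lborel))\<^sup>2 \<le>
        C\<^sup>2 * ((\<integral>y. (?h y)\<^sup>2 \<partial>lborel) * (\<integral>y. (?h y * \<bar>v y\<bar>)\<^sup>2 \<partial>lborel))"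
      unfolding power_mult_distrib[of C]
      by (intro mult_left_mono Cauchy_Schwarz_square_integrable 1 2) simp
    also have "(\<lambda>y. (?h y * \<bar>v y\<bar>)\<^sup>2) = (\<lambda>y. ?e x y * (v y)\<^sup>2)"
    proof
      show "(?h y * \<bar>v y\<bar>)\<^sup>2 = ?e x y * (v y)\<^sup>2" for y
        unfolding power_mult_distrib power2_abs power2_eq_square[of "?h y"] hh ..
    qed
    also have "(\<lambda>y. (?h y)\<^sup>2) = ?e x"
      using hh by (simp add: power2_eq_square)
    finally show ?thesis
      using exp_kernel_integral(2)[OF k] by (simp add: g_def)
  qed
  have int: "integrable lborel (\<lambda>x. (f x)\<^sup>2)"
    by (rule Bochner_Integration.integrable_bound[where f = "\<lambda>x. C\<^sup>2 * ?J * g x"])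
      (use g f bound J in \<open>auto intro: order_trans[OF bound abs_ge_self]\<close>)
  then show "square_integrable f" using f by (simp add: square_integrable_def)
  have "(\<integral>x. (f x)\<^sup>2 \<partial>lborel) \<le> (\<integral>x. C\<^sup>2 * ?J * g x \<partial>lborel)"
    using int g bound by (intro integral_mono) auto
  then show "(\<integral>x. (f x)\<^sup>2 \<partial>lborel) \<le> (C * ?J)\<^sup>2 * (\<integral>x. (v x)\<^sup>2 \<partial>lborel)"
    by (simp add: Ig power2_eq_square mult_ac)
qed

section \<open>Resolvents\<close>

text \<open>Solutions with a uniform norm bound are chosen for each right-hand side; the trivial
  kernel makes them unique, and uniqueness in a linear graph makes the choice linear.\<close>

lemma resolvent_setI:
  fixes T :: "('a::real_normed_vector \<times> 'a) set"
  assumes T: "subspace T"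
    and ex: "\<And>v. \<exists>u. (u, v + E *\<^sub>R u) \<in> T \<and> norm u \<le> C * norm v"
    and ker: "\<And>u. (u, E *\<^sub>R u) \<in> T \<Longrightarrow> u = 0"
  shows "E \<in> resolvent_set T"
proof -
  obtain R where R: "\<And>v. (R v, v + E *\<^sub>R R v) \<in> T" "\<And>v. norm (R v) \<le> C * norm v"
    using ex by metis
  have uniq: "u = R v" if "(u, v + E *\<^sub>R u) \<in> T" for u v
  proof -
    have "(u, v + E *\<^sub>R u) - (R v, v + E *\<^sub>R R v) \<in> T"
      by (rule subspace_diff[OF T that R(1)])
    then have "(u - R v, E *\<^sub>R (u - R v)) \<in> T" by (simp add: algebra_simps)
    from ker[OF this] show ?thesis by simp
  qed
  have "bounded_linear R"
  proof (rule bounded_linear_intro)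
    show "R (v + w) = R v + R w" for v w
      using subspace_add[OF T R(1)[of v] R(1)[of w]]
      by (intro uniq[symmetric]) (simp add: algebra_simps)
    show "R (r *\<^sub>R v) = r *\<^sub>R R v" for r v
      using subspace_scale[OF T R(1)[of v], of r]
      by (intro uniq[symmetric]) (simp add: algebra_simps)
    show "norm (R v) \<le> norm v * C" for v using R(2)[of v] by (simp add: mult.commute)
  qed
  moreover have "(\<exists>w. (u, w) \<in> T \<and> w - E *\<^sub>R u = v) \<longleftrightarrow> u = R v" for u v
  proof
    assume "\<exists>w. (u, w) \<in> T \<and> w - E *\<^sub>R u = v"
    then show "u = R v" by (intro uniq) (auto simp: algebra_simps)
  next
    assume "u = R v"
    then show "\<exists>w. (u, w) \<in> T \<and> w - E *\<^sub>R u = v"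
      using R(1)[of v] by (intro exI[of _ "v + E *\<^sub>R R v"]) simp
  qed
  ultimately show ?thesis unfolding resolvent_set_def by blast
qed

lemma schroedingerI:
  assumes "AE x in lborel. l2_fun u x = f x" "ac_derivative f f'" "ac_derivative f' f''"
    "AE x in lborel. l2_fun v x = - f'' x + V x * f x"
  shows "(u, v) \<in> schroedinger V"
  using assms unfolding schroedinger_def by blast

lemma subspace_schroedinger: "subspace (schroedinger V)"
proof (rule subspaceI)
  show "0 \<in> schroedinger V"
    unfolding schroedinger_def zero_prod_def
    by (auto intro!: exI[of _ "\<lambda>_. 0"] ac_derivative_const l2_fun_zero)
next
  fix p q assume "p \<in> schroedinger V" "q \<in> schroedinger V"
  then obtain u v u' v' f g h f' g' h' where pq: "p = (u, v)" "q = (u', v')"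
    and ac: "ac_derivative f g" "ac_derivative g h" "ac_derivative f' g'" "ac_derivative g' h'"
    and ae: "AE x in lborel. l2_fun u x = f x" "AE x in lborel. l2_fun v x = - h x + V x * f x"
      "AE x in lborel. l2_fun u' x = f' x" "AE x in lborel. l2_fun v' x = - h' x + V x * f' x"
    unfolding schroedinger_def by auto
  have "AE x in lborel. l2_fun (u + u') x = f x + f' x"
    using ae(1,3) l2_fun_add[of u u'] by eventually_elim simp
  moreover have "AE x in lborel. l2_fun (v + v') x = - (h x + h' x) + V x * (f x + f' x)"
    using ae(2,4) l2_fun_add[of v v'] by eventually_elim (simp add: algebra_simps)
  ultimately show "p + q \<in> schroedinger V"
    unfolding pq add_Pair
    by (rule schroedingerI[OF _ ac_derivative_add[OF ac(1,3)] ac_derivative_add[OF ac(2,4)]])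
next
  fix r :: real and p assume "p \<in> schroedinger V"
  then obtain u v f g h where p: "p = (u, v)"
    and ac: "ac_derivative f g" "ac_derivative g h"
    and ae: "AE x in lborel. l2_fun u x = f x" "AE x in lborel. l2_fun v x = - h x + V x * f x"
    unfolding schroedinger_def by auto
  have "AE x in lborel. l2_fun (r *\<^sub>R u) x = r * f x"
    using ae(1) l2_fun_scaleR[of r u] by eventually_elim simp
  moreover have "AE x in lborel. l2_fun (r *\<^sub>R v) x = - (r * h x) + V x * (r * f x)"
    using ae(2) l2_fun_scaleR[of r v] by eventually_elim algebra
  ultimately show "r *\<^sub>R p \<in> schroedinger V"
    unfolding p scaleR_Pair
    by (rule schroedingerI[OF _ ac_derivative_cmult[OF ac(1)] ac_derivative_cmult[OF ac(2)]])
qed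

section \<open>Floquet solutions\<close>

lemma wronskian_const:
  assumes 1: "schroedinger_solution W u v" and 2: "schroedinger_solution W u' v'"
  shows "u t * v' t - v t * u' t = u s * v' s - v s * u' s"
  using wronskian_eq[OF 1 2, of s t] wronskian_eq[OF 1 2, of t s] by (cases "s \<le> t") auto

text \<open>Cramer's rule, with coefficients that are quotients of Wronskians and hence
  constant.\<close>

lemma schroedinger_solution_in_span:
  assumes e1: "schroedinger_solution W e1 d1" and e2: "schroedinger_solution W e2 d2"
    and uv: "schroedinger_solution W u v" and w: "e1 s * d2 s - d1 s * e2 s \<noteq> 0"
  obtains \<alpha> \<beta> where "\<And>x. u x = \<alpha> * e1 x + \<beta> * e2 x" "\<And>x. v x = \<alpha> * d1 x + \<beta> * d2 x"
proof
  let ?w = "e1 s * d2 s - d1 s * e2 s"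
  let ?a = "u s * d2 s - v s * e2 s" and ?b = "e1 s * v s - d1 s * u s"
  fix x
  have "e1 x * d2 x - d1 x * e2 x = ?w" "u x * d2 x - v x * e2 x = ?a" "e1 x * v x - d1 x * u x = ?b"
    using wronskian_const[OF e1 e2] wronskian_const[OF uv e2] wronskian_const[OF e1 uv] by blast+
  then have "u x * ?w = ?a * e1 x + ?b * e2 x" "v x * ?w = ?a * d1 x + ?b * d2 x"
    by algebra+
  with w show "u x = ?a / ?w * e1 x + ?b / ?w * e2 x" "v x = ?a / ?w * d1 x + ?b / ?w * d2 x"
    by (simp_all add: divide_simps)
qed

lemma schroedinger_solution_unique:
  assumes W: "locally_integrable W"
    and 1: "schroedinger_solution W u v" and 2: "schroedinger_solution W u' v'"
    and s: "u s = u' s" "v s = v' s"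
  shows "u x = u' x"
proof -
  obtain e1 d1 e2 d2 where e: "schroedinger_solution W e1 d1" "e1 s = 1" "d1 s = 0"
    "schroedinger_solution W e2 d2" "e2 s = 0" "d2 s = 1"
    using schroedinger_solution_exists[OF W] by metis
  have w: "e1 s * d2 s - d1 s * e2 s \<noteq> 0" using e by simp
  obtain \<alpha> \<beta> where a: "\<And>x. u x = \<alpha> * e1 x + \<beta> * e2 x" "\<And>x. v x = \<alpha> * d1 x + \<beta> * d2 x"
    using schroedinger_solution_in_span[OF e(1,4) 1 w] by metis
  obtain \<alpha>' \<beta>' where b: "\<And>x. u' x = \<alpha>' * e1 x + \<beta>' * e2 x" "\<And>x. v' x = \<alpha>' * d1 x + \<beta>' * d2 x"
    using schroedinger_solution_in_span[OF e(1,4) 2 w] by metis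
  have "\<alpha> = \<alpha>'" "\<beta> = \<beta>'" using s e a[of s] b[of s] by simp_all
  then show ?thesis using a(1) b(1) by simp
qed

text \<open>The candidates are the columns of the adjugate of x I - M, which are annihilated by x I
  - M. If both vanish, M is x I and any nonzero vector will do.\<close>

lemma eigenvector2:
  fixes M :: "real^2^2"
  assumes "x\<^sup>2 - trace M * x + det M = 0"
  shows "\<exists>a b. (a, b) \<noteq> (0, 0) \<and> M$1$1 * a + M$1$2 * b = x * a \<and> M$2$1 * a + M$2$2 * b = x * b"
proof -
  have c: "(x - M$1$1) * (x - M$2$2) = M$1$2 * M$2$1"
    using assms unfolding trace2 det_2 by algebra
  consider "(M$1$2, x - M$1$1) \<noteq> (0, 0)" | "(x - M$2$2, M$2$1) \<noteq> (0, 0)" "(M$1$2, x - M$1$1) = (0, 0)"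
    | "(M$1$2, x - M$1$1) = (0, 0)" "(x - M$2$2, M$2$1) = (0, 0)" by blast
  then show ?thesis
  proof cases
    case 1
    then show ?thesis using c
      by (intro exI[of _ "M$1$2"] exI[of _ "x - M$1$1"]) (auto simp: algebra_simps)
  next
    case 2
    then show ?thesis
      by (intro exI[of _ "x - M$2$2"] exI[of _ "M$2$1"]) (auto simp: algebra_simps)
  next
    case 3
    then show ?thesis by (intro exI[of _ 1] exI[of _ 0]) auto
  qed
qed

lemma hyperbolic_eigenvalue:
  fixes M :: "real^2^2"
  assumes d: "det M = 1" and t: "2 < \<bar>trace M\<bar>"
  obtains \<rho> where "1 < \<bar>\<rho>\<bar>" "\<rho>\<^sup>2 - trace M * \<rho> + det M = 0" "(1 / \<rho>)\<^sup>2 - trace M * (1 / \<rho>) + det M = 0"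
proof -
  define r where "r = sqrt ((trace M)\<^sup>2 - 4)"
  have t4: "4 < (trace M)\<^sup>2" using power_strict_mono[of 2 "\<bar>trace M\<bar>" 2] t by simp
  then have r: "0 < r" "r\<^sup>2 = (trace M)\<^sup>2 - 4" by (simp_all add: r_def)
  \<comment> \<open>The sign of the trace selects the root of larger modulus; since the determinant
    is 1, the other root is its reciprocal.\<close>
  define \<rho> where "\<rho> = (trace M + sgn (trace M) * r) / 2"
  have sg: "(sgn (trace M))\<^sup>2 = 1" using t by (auto simp: sgn_if)
  have 1: "\<rho>\<^sup>2 - trace M * \<rho> + 1 = 0"
  proof -
    have "4 * (\<rho>\<^sup>2 - trace M * \<rho> + 1) = (sgn (trace M))\<^sup>2 * r\<^sup>2 - ((trace M)\<^sup>2 - 4)"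
      by (simp add: \<rho>_def power2_eq_square field_simps)
    then show ?thesis by (simp add: sg r)
  qed
  have 2: "1 < \<bar>\<rho>\<bar>" using t r by (auto simp: \<rho>_def sgn_if abs_if split: if_splits)
  then have "\<rho> \<noteq> 0" by auto
  then have "(1 / \<rho>)\<^sup>2 - trace M * (1 / \<rho>) + 1 = (\<rho>\<^sup>2 - trace M * \<rho> + 1) / \<rho>\<^sup>2"
    by (simp add: power2_eq_square field_simps)
  with 1 2 d show thesis by (intro that[of \<rho>]) simp_all
qed

lemma periodic_int_mult:
  fixes f :: "real \<Rightarrow> 'a"
  assumes "\<And>x. f (x + P) = f x"
  shows "f (x + of_int n * P) = f x"
proof (induction n rule: int_induct[of _ 0])
  case (step1 i)
  then show ?case using assms[of "x + of_int i * P"] by (simp add: algebra_simps)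
next
  case (step2 i)
  then show ?case using assms[of "x + of_int (i - 1) * P"] by (simp add: algebra_simps)
qed simp

lemma periodic_continuous_bounded:
  fixes f :: "real \<Rightarrow> real"
  assumes f: "continuous_on UNIV f" and P: "0 < P" and per: "\<And>x. f (x + P) = f x"
  obtains C where "\<And>x. \<bar>f x\<bar> \<le> C"
proof -
  have "compact (f ` {0..P})"
    using f by (intro compact_continuous_image) (auto elim: continuous_on_subset)
  from compact_imp_bounded[OF this] obtain C where C: "\<And>x. x \<in> {0..P} \<Longrightarrow> \<bar>f x\<bar> \<le> C"
    by (force simp: bounded_iff)
  have "\<bar>f x\<bar> \<le> C" for x
  proof -
    have "x + of_int (- \<lfloor>x / P\<rfloor>) * P \<in> {0..P}"
      using P floor_divide_lower[of P x] floor_divide_upper[of P x] by (auto simp: algebra_simps)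
    from C[OF this] show ?thesis by (simp only: periodic_int_mult[of f, OF per])
  qed
  then show thesis by (rule that)
qed

lemma floquet_bound:
  fixes u :: "real \<Rightarrow> real"
  assumes u: "continuous_on UNIV u" and P: "0 < P" and \<rho>: "\<rho> \<noteq> 0"
    and per: "\<And>x. u (x + P) = \<rho> * u x"
  obtains C where "\<And>x. \<bar>u x\<bar> \<le> C * exp (ln \<bar>\<rho>\<bar> / P * x)"
proof -
  define k where "k = ln \<bar>\<rho>\<bar> / P"
  have 1: "continuous_on UNIV (\<lambda>x. u x * exp (- k * x))"
    by (intro continuous_intros u)
  \<comment> \<open>As \<open>\<rho>\<close> may be negative, the rescaled function is periodic only
    up to sign; its absolute value is periodic.\<close>
  have 2: "\<bar>u (x + P) * exp (- k * (x + P))\<bar> = \<bar>u x * exp (- k * x)\<bar>" for x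
  proof -
    have "- k * (x + P) = - k * x - ln \<bar>\<rho>\<bar>" using P by (simp add: k_def field_simps)
    then have "exp (- k * (x + P)) = exp (- k * x) / \<bar>\<rho>\<bar>" using \<rho> by (simp add: exp_diff)
    then show ?thesis using \<rho> by (simp add: per abs_mult)
  qed
  obtain C where C: "\<And>x. \<bar>\<bar>u x * exp (- k * x)\<bar>\<bar> \<le> C"
    using periodic_continuous_bounded[OF continuous_on_rabs[OF 1] P 2] by blast
  have "\<bar>u x\<bar> \<le> C * exp (k * x)" for x
  proof -
    have "\<bar>u x\<bar> = \<bar>u x * exp (- k * x)\<bar> * exp (k * x)"
      by (simp add: abs_mult exp_minus)
    also have "\<dots> \<le> C * exp (k * x)" using C[of x] by (intro mult_right_mono) auto
    finally show ?thesis .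
  qed
  then show thesis unfolding k_def by (rule that)
qed

text \<open>With an eigenvector as initial data, the translate by \<open>P\<close> and the multiple
  by \<open>\<rho>\<close> solve the same equation with equal data at \<open>s\<close>.\<close>

lemma floquet_solution:
  assumes W: "locally_integrable W" and per: "\<And>x. W (x + P) = W x"
    and M: "transfers W s (s + P) M" and e: "M$1$1 * a + M$1$2 * b = \<rho> * a" "M$2$1 * a + M$2$2 * b = \<rho> * b"
  obtains u v where "schroedinger_solution W u v" "u s = a" "v s = b" "\<And>x. u (x + P) = \<rho> * u x"
proof -
  obtain u v where uv: "schroedinger_solution W u v" "u s = a" "v s = b"
    using schroedinger_solution_exists[OF W] by blast
  have 1: "schroedinger_solution W (\<lambda>x. u (x + P)) (\<lambda>x. v (x + P))"
    using schroedinger_solution_shift[OF uv(1), of P] by (simp add: per)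
  have 2: "schroedinger_solution W (\<lambda>x. \<rho> * u x) (\<lambda>x. \<rho> * v x)"
    using schroedinger_solution_combination[OF uv(1) uv(1), of \<rho> 0] by simp
  have 3: "u (s + P) = \<rho> * u s" "v (s + P) = \<rho> * v s"
    using M uv e by (auto simp: transfers_def)
  show thesis
    by (rule that[OF uv schroedinger_solution_unique[OF W 1 2 3]])
qed

section \<open>Green function and resolvent estimate\<close>

lemma ac_derivative_integral_left:
  assumes q: "\<And>x. integrable lborel (\<lambda>y. indicator {..x} y * q y)"
  shows "ac_derivative (\<lambda>x. \<integral>y. indicator {..x} y * q y \<partial>lborel) q"
proof (rule ac_derivativeI)
  have "integrable lborel (\<lambda>x. indicator {s..t} x *\<^sub>R (indicator {..t} x * q x))" for s t
    by (rule integrable_mult_indicator) (use q in auto)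
  moreover have "(\<lambda>x. indicator {s..t} x *\<^sub>R (indicator {..t} x * q x)) = (\<lambda>x. indicator {s..t} x *\<^sub>R q x)" for s t
    by (auto simp: fun_eq_iff split: split_indicator)
  ultimately show l: "locally_integrable q"
    unfolding locally_integrable_def set_integrable_def by simp
  fix s t :: real assume st: "s \<le> t"
  have "(\<integral>y. indicator {..t} y * q y \<partial>lborel) - (\<integral>y. indicator {..s} y * q y \<partial>lborel) =
      (\<integral>y. indicator {..t} y * q y - indicator {..s} y * q y \<partial>lborel)"
    by (rule Bochner_Integration.integral_diff[OF q q, symmetric])
  also have "\<dots> = (LBINT x:{s..t}. q x)"
    unfolding set_lebesgue_integral_def
  proof (rule integral_cong_AE)
    have "AE y in lborel. y \<noteq> s" by (rule AE_lborel_singleton)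
    then show "AE y in lborel. indicator {..t} y * q y - indicator {..s} y * q y = indicator {s..t} y *\<^sub>R q y"
      by eventually_elim (use st in \<open>auto split: split_indicator\<close>)
  qed (use q locally_integrableD[OF l, of s t] in \<open>auto simp: set_integrable_def\<close>)
  finally show "(LBINT x:{s..t}. q x) =
      (\<integral>y. indicator {..t} y * q y \<partial>lborel) - (\<integral>y. indicator {..s} y * q y \<partial>lborel)" ..
qed

lemma ac_derivative_integral_right:
  assumes q: "\<And>x. integrable lborel (\<lambda>y. indicator {x..} y * q y)"
  shows "ac_derivative (\<lambda>x. \<integral>y. indicator {x..} y * q y \<partial>lborel) (\<lambda>x. - 1 * q x)"
proof (rule ac_derivativeI)
  have "integrable lborel (\<lambda>x. indicator {s..t} x *\<^sub>R (indicator {s..} x * q x))" for s t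
    by (rule integrable_mult_indicator) (use q in auto)
  moreover have "(\<lambda>x. indicator {s..t} x *\<^sub>R (indicator {s..} x * q x)) = (\<lambda>x. indicator {s..t} x *\<^sub>R q x)" for s t
    by (auto simp: fun_eq_iff split: split_indicator)
  ultimately have l: "locally_integrable q"
    unfolding locally_integrable_def set_integrable_def by simp
  then show "locally_integrable (\<lambda>x. - 1 * q x)" by (rule locally_integrable_cmult)
  fix s t :: real assume st: "s \<le> t"
  have "(\<integral>y. indicator {s..} y * q y \<partial>lborel) - (\<integral>y. indicator {t..} y * q y \<partial>lborel) =
      (\<integral>y. indicator {s..} y * q y - indicator {t..} y * q y \<partial>lborel)"
    by (rule Bochner_Integration.integral_diff[OF q q, symmetric])
  also have "\<dots> = (LBINT x:{s..t}. q x)"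
    unfolding set_lebesgue_integral_def
  proof (rule integral_cong_AE)
    have "AE y in lborel. y \<noteq> t" by (rule AE_lborel_singleton)
    then show "AE y in lborel. indicator {s..} y * q y - indicator {t..} y * q y = indicator {s..t} y *\<^sub>R q y"
      by eventually_elim (use st in \<open>auto split: split_indicator\<close>)
  qed (use q locally_integrableD[OF l, of s t] in \<open>auto simp: set_integrable_def\<close>)
  finally show "(LBINT x:{s..t}. - 1 * q x) =
      (\<integral>y. indicator {t..} y * q y \<partial>lborel) - (\<integral>y. indicator {s..} y * q y \<partial>lborel)"
    by (subst set_integral_mult_right) simp
qed

lemma schroedinger_solution_measurable:
  "schroedinger_solution W u v \<Longrightarrow> u \<in> borel_measurable borel"
  unfolding schroedinger_solution_def
  by (intro borel_measurable_continuous_onI ac_derivative_continuous) auto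

text \<open>Solves \<open>- f'' + W f = g\<close> with the Green function \<open>u (max x y) * u' (min x y) / w\<close>.\<close>

lemma green_solution:
  assumes uv: "schroedinger_solution W u v" and uv': "schroedinger_solution W u' v'"
    and w: "\<And>x. u x * v' x - v x * u' x = w" "w \<noteq> 0" and k: "0 < k"
    and bu: "\<And>x. \<bar>u x\<bar> \<le> C * exp (- k * x)" and bu': "\<And>x. \<bar>u' x\<bar> \<le> C * exp (k * x)"
    and g: "square_integrable g"
  shows "\<exists>f f'. ac_derivative f f' \<and> ac_derivative f' (\<lambda>x. W x * f x - g x) \<and> square_integrable f \<and>
    (\<integral>x. (f x)\<^sup>2 \<partial>lborel) \<le> (2 * C\<^sup>2 / \<bar>w\<bar> * exp_kernel_mass k)\<^sup>2 * (\<integral>x. (g x)\<^sup>2 \<partial>lborel)"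
proof -
  have [measurable]: "u \<in> borel_measurable borel" "u' \<in> borel_measurable borel" "g \<in> borel_measurable borel"
    using schroedinger_solution_measurable uv uv' g by (auto simp: square_integrable_def)
  have C: "0 \<le> C" using bu[of 0] by simp
  define I where "I x = (\<integral>y. exp (- k * \<bar>x - y\<bar>) * \<bar>g y\<bar> \<partial>lborel)" for x
  have "square_integrable (\<lambda>y. \<bar>g y\<bar>)" using g by (simp add: square_integrable_def)
  from square_integrable_mult[OF square_integrable_exp_kernel[OF k] this]
  have intI: "integrable lborel (\<lambda>y. exp (- k * \<bar>x - y\<bar>) * \<bar>g y\<bar>)" for x .
  have tail: "integrable lborel (\<lambda>y. indicator S y * (h y * g y)) \<and>
      \<bar>\<integral>y. indicator S y * (h y * g y) \<partial>lborel\<bar> \<le> D * I x"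
    if [measurable]: "S \<in> sets borel" "h \<in> borel_measurable borel" and D: "0 \<le> D"
      and le: "\<And>y. y \<in> S \<Longrightarrow> \<bar>h y\<bar> \<le> D * exp (- k * \<bar>x - y\<bar>)" for S h D x
  proof -
    have le': "\<bar>indicator S y * (h y * g y)\<bar> \<le> D * (exp (- k * \<bar>x - y\<bar>) * \<bar>g y\<bar>)" for y
      using mult_right_mono[OF le, of y "\<bar>g y\<bar>"] D by (cases "y \<in> S") (simp_all add: abs_mult mult.assoc)
    have int: "integrable lborel (\<lambda>y. D * (exp (- k * \<bar>x - y\<bar>) * \<bar>g y\<bar>))"
      by (intro integrable_mult_right intI)
    have 1: "integrable lborel (\<lambda>y. indicator S y * (h y * g y))"
    proof (rule Bochner_Integration.integrable_bound[OF int])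
      show "AE y in lborel. norm (indicator S y * (h y * g y)) \<le> norm (D * (exp (- k * \<bar>x - y\<bar>) * \<bar>g y\<bar>))"
        using order_trans[OF le' abs_ge_self] by simp
    qed measurable
    have "\<bar>\<integral>y. indicator S y * (h y * g y) \<partial>lborel\<bar> \<le> (\<integral>y. \<bar>indicator S y * (h y * g y)\<bar> \<partial>lborel)"
      by (rule integral_abs_bound)
    also have "\<dots> \<le> (\<integral>y. D * (exp (- k * \<bar>x - y\<bar>) * \<bar>g y\<bar>) \<partial>lborel)"
      by (intro integral_mono integrable_abs 1 int le')
    finally show ?thesis using 1 by (simp add: I_def)
  qed
  \<comment> \<open>On each side of \<open>x\<close> the exponential bound splits into its value at
    \<open>x\<close> and the decaying kernel; multiplied by the bound for the other Floquet solution
    at \<open>x\<close>, the factors depending on \<open>x\<close> alone cancel.\<close>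
  have exps: "exp (k * y) = exp (k * x) * exp (- k * \<bar>x - y\<bar>)" if "y \<le> x" for x y
    using that by (simp add: algebra_simps flip: exp_add)
  have exps': "exp (- k * y) = exp (- k * x) * exp (- k * \<bar>x - y\<bar>)" if "x \<le> y" for x y
    using that by (simp add: algebra_simps flip: exp_add)
  define A where "A x = (\<integral>y. indicator {..x} y * (u' y * g y) \<partial>lborel)" for x
  define B where "B x = (\<integral>y. indicator {x..} y * (u y * g y) \<partial>lborel)" for x
  have tA: "integrable lborel (\<lambda>y. indicator {..x} y * (u' y * g y)) \<and> \<bar>A x\<bar> \<le> (C * exp (k * x)) * I x" for x
    unfolding A_def
  proof (rule tail)
    show "\<bar>u' y\<bar> \<le> C * exp (k * x) * exp (- k * \<bar>x - y\<bar>)" if "y \<in> {..x}" for y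
      using bu'[of y] exps[of y x] that by (simp add: mult.assoc)
  qed (use C in auto)
  have tB: "integrable lborel (\<lambda>y. indicator {x..} y * (u y * g y)) \<and> \<bar>B x\<bar> \<le> (C * exp (- k * x)) * I x" for x
    unfolding B_def
  proof (rule tail)
    show "\<bar>u y\<bar> \<le> C * exp (- k * x) * exp (- k * \<bar>x - y\<bar>)" if "y \<in> {x..}" for y
      using bu[of y] exps'[of x y] that by (simp add: mult.assoc)
  qed (use C in auto)
  have dA: "ac_derivative A (\<lambda>x. u' x * g x)"
    unfolding A_def using tA by (intro ac_derivative_integral_left) blast
  have dB: "ac_derivative B (\<lambda>x. - 1 * (u x * g x))"
    unfolding B_def using tB by (intro ac_derivative_integral_right) blast
  have d: "ac_derivative u v" "ac_derivative v (\<lambda>x. W x * u x)"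
    "ac_derivative u' v'" "ac_derivative v' (\<lambda>x. W x * u' x)"
    using uv uv' by (simp_all add: schroedinger_solution_def)
  \<comment> \<open>Variation of constants: the terms with \<open>g\<close> cancel in the first
    derivative, and in the second they combine, through the Wronskian \<open>w\<close>, to
    \<open>- g x\<close>.\<close>
  define f where "f x = 1 / w * (u x * A x + u' x * B x)" for x
  define f' where "f' x = 1 / w * (v x * A x + v' x * B x)" for x
  have f_meas: "ac_derivative f f'"
  proof -
    have "ac_derivative f (\<lambda>x. 1 / w * ((v x * A x + u x * (u' x * g x)) + (v' x * B x + u' x * (- 1 * (u x * g x)))))"
      unfolding f_def by (intro ac_derivative_cmult ac_derivative_add ac_derivative_mult d dA dB)
    also have "(\<lambda>x. 1 / w * ((v x * A x + u x * (u' x * g x)) + (v' x * B x + u' x * (- 1 * (u x * g x))))) = f'"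
      by (simp add: fun_eq_iff f'_def mult_ac)
    finally show ?thesis .
  qed
  moreover have "ac_derivative f' (\<lambda>x. W x * f x - g x)"
  proof -
    have "ac_derivative f' (\<lambda>x. 1 / w * (((W x * u x) * A x + v x * (u' x * g x)) +
        ((W x * u' x) * B x + v' x * (- 1 * (u x * g x)))))"
      unfolding f'_def by (intro ac_derivative_cmult ac_derivative_add ac_derivative_mult d dA dB)
    also have "(\<lambda>x. 1 / w * (((W x * u x) * A x + v x * (u' x * g x)) +
        ((W x * u' x) * B x + v' x * (- 1 * (u x * g x))))) = (\<lambda>x. W x * f x - g x)"
    proof
      fix x
      have "((W x * u x) * A x + v x * (u' x * g x)) + ((W x * u' x) * B x + v' x * (- 1 * (u x * g x)))
          = W x * (u x * A x + u' x * B x) - w * g x"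
        unfolding w(1)[of x, symmetric] by algebra
      then show "1 / w * (((W x * u x) * A x + v x * (u' x * g x)) +
          ((W x * u' x) * B x + v' x * (- 1 * (u x * g x)))) = W x * f x - g x"
        using w(2) by (simp add: f_def diff_divide_distrib)
    qed
    finally show ?thesis .
  qed
  moreover have le: "\<bar>f x\<bar> \<le> 2 * C\<^sup>2 / \<bar>w\<bar> * I x" for x
  proof -
    have ee: "exp (- k * x) * exp (k * x) = 1" by (simp flip: exp_add)
    have "\<bar>u x * A x\<bar> \<le> (C * exp (- k * x)) * ((C * exp (k * x)) * I x)"
      unfolding abs_mult using tA[of x] bu[of x] C by (intro mult_mono) auto
    also have "\<dots> = C\<^sup>2 * I x" using ee by algebra
    finally have "\<bar>u x * A x\<bar> \<le> C\<^sup>2 * I x" .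
    moreover have "\<bar>u' x * B x\<bar> \<le> (C * exp (k * x)) * ((C * exp (- k * x)) * I x)"
      unfolding abs_mult using tB[of x] bu'[of x] C by (intro mult_mono) auto
    moreover have "(C * exp (k * x)) * ((C * exp (- k * x)) * I x) = C\<^sup>2 * I x" using ee by algebra
    ultimately have "\<bar>u x * A x + u' x * B x\<bar> \<le> 2 * C\<^sup>2 * I x" by linarith
    then show ?thesis using w(2) by (simp add: f_def abs_mult divide_simps)
  qed
  moreover have "f \<in> borel_measurable borel"
    using f_meas by (intro borel_measurable_continuous_onI ac_derivative_continuous)
  ultimately show ?thesis
    using Schur_test_exp_kernel[OF k g, of f "2 * C\<^sup>2 / \<bar>w\<bar>"] unfolding I_def by blast
qed

text \<open>Translation by \<open>P\<close> preserves the integral of the square but also multiplies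
  it by \<open>\<rho>\<^sup>2\<close>, which differs from 1.\<close>

lemma floquet_square_integrable_imp_zero:
  assumes h: "square_integrable h" and per: "\<And>x. h (x + P) = \<rho> * h x" and \<rho>: "\<bar>\<rho>\<bar> \<noteq> 1"
  shows "AE x in lborel. h x = 0"
proof -
  have int: "integrable lborel (\<lambda>x. (h x)\<^sup>2)" using h by (simp add: square_integrable_def)
  have "(\<integral>x. (h x)\<^sup>2 \<partial>lborel) = (\<integral>x. (h (x + P))\<^sup>2 \<partial>lborel)"
    using lborel_integral_real_affine[of 1 "\<lambda>x. (h x)\<^sup>2" P] by (simp add: add.commute)
  also have "\<dots> = \<rho>\<^sup>2 * (\<integral>x. (h x)\<^sup>2 \<partial>lborel)"
    by (simp add: per power_mult_distrib)
  finally have "(1 - \<rho>\<^sup>2) * (\<integral>x. (h x)\<^sup>2 \<partial>lborel) = 0" by (simp add: algebra_simps)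
  moreover have "\<rho>\<^sup>2 \<noteq> 1" using \<rho> by (auto simp: power2_eq_1_iff)
  ultimately have "(\<integral>x. (h x)\<^sup>2 \<partial>lborel) = 0" by simp
  then show ?thesis
    using integral_nonneg_eq_0_iff_AE[OF int] by simp
qed

lemma hyperbolic_in_resolvent_set:
  assumes V: "locally_integrable V" and P: "0 < P" and per: "\<And>x. V (x + P) = V x"
    and M: "transfers (\<lambda>x. V x - E) s (s + P) M" and tr: "2 < \<bar>trace M\<bar>"
  shows "E \<in> resolvent_set (schroedinger V)"
proof -
  define W where "W x = V x - E" for x
  have W: "locally_integrable W"
    unfolding W_def by (intro locally_integrable_diff V locally_integrable_continuous) auto
  have perW: "W (x + P) = W x" for x by (simp add: W_def per)
  have M: "transfers W s (s + P) M" using M unfolding W_def .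
  have "det M = 1" using transfers_det[OF M W] P by simp
  from hyperbolic_eigenvalue[OF this tr] obtain \<rho> where \<rho>: "1 < \<bar>\<rho>\<bar>"
    "\<rho>\<^sup>2 - trace M * \<rho> + det M = 0" "(1 / \<rho>)\<^sup>2 - trace M * (1 / \<rho>) + det M = 0" by metis
  have \<rho>0: "\<rho> \<noteq> 0" and \<rho>1: "1 / \<rho> \<noteq> \<rho>" and \<rho>2: "\<bar>1 / \<rho>\<bar> \<noteq> 1"
  proof -
    show 0: "\<rho> \<noteq> 0" using \<rho>(1) by auto
    have "\<bar>1 / \<rho>\<bar> < 1" using \<rho>(1) by (simp add: divide_simps)
    then show "1 / \<rho> \<noteq> \<rho>" "\<bar>1 / \<rho>\<bar> \<noteq> 1" using \<rho>(1) by (auto simp del: abs_divide)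
  qed
  obtain a b where ab: "(a, b) \<noteq> (0, 0)" "M$1$1 * a + M$1$2 * b = (1 / \<rho>) * a" "M$2$1 * a + M$2$2 * b = (1 / \<rho>) * b"
    using eigenvector2[OF \<rho>(3)] by blast
  obtain c d where cd: "(c, d) \<noteq> (0, 0)" "M$1$1 * c + M$1$2 * d = \<rho> * c" "M$2$1 * c + M$2$2 * d = \<rho> * d"
    using eigenvector2[OF \<rho>(2)] by blast
  \<comment> \<open>Eigenvectors for the distinct eigenvalues \<open>1 / \<rho>\<close> and
    \<open>\<rho>\<close> are not parallel; the determinant in question becomes the Wronskian of the
    Floquet solutions.\<close>
  have w0: "a * d - b * c \<noteq> 0"
  proof
    assume 0: "a * d - b * c = 0"
    have "(1 / \<rho> - \<rho>) * (a * c) = 0" "(1 / \<rho> - \<rho>) * (b * d) = 0" "(1 / \<rho> - \<rho>) * (a * d) = 0"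
      using 0 ab(2,3) cd(2,3) by algebra+
    with \<rho>1 have "a * c = 0" "b * d = 0" "a * d = 0" by simp_all
    with 0 ab(1) cd(1) show False by auto
  qed
  obtain u v where uv: "schroedinger_solution W u v" "u s = a" "v s = b" "\<And>x. u (x + P) = (1 / \<rho>) * u x"
    using floquet_solution[OF W perW M ab(2,3)] by metis
  obtain u' v' where uv': "schroedinger_solution W u' v'" "u' s = c" "v' s = d" "\<And>x. u' (x + P) = \<rho> * u' x"
    using floquet_solution[OF W perW M cd(2,3)] by metis
  define w where "w = a * d - b * c"
  have w: "u x * v' x - v x * u' x = w" for x
    using wronskian_const[OF uv(1) uv'(1), of x s] uv uv' by (simp add: w_def)
  define k where "k = ln \<bar>\<rho>\<bar> / P"
  have k: "0 < k" using \<rho>(1) P by (simp add: k_def)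
  have cont: "continuous_on UNIV u" "continuous_on UNIV u'"
    using uv(1) uv'(1) unfolding schroedinger_solution_def by (auto intro: ac_derivative_continuous)
  have "ln \<bar>1 / \<rho>\<bar> / P = - k" using \<rho>0 by (simp add: k_def ln_div)
  then obtain C1 where C1: "\<And>x. \<bar>u x\<bar> \<le> C1 * exp (- k * x)"
    using floquet_bound[OF cont(1) P _ uv(4)] \<rho>0 by (metis divide_eq_0_iff one_neq_zero)
  obtain C2 where C2: "\<And>x. \<bar>u' x\<bar> \<le> C2 * exp (k * x)"
    using floquet_bound[OF cont(2) P \<rho>0 uv'(4)] unfolding k_def by metis
  define C where "C = max C1 C2"
  have bu: "\<bar>u x\<bar> \<le> C * exp (- k * x)" for x
    using order_trans[OF C1[of x] mult_right_mono[of C1 C "exp (- k * x)"]] by (simp add: C_def)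
  have bu': "\<bar>u' x\<bar> \<le> C * exp (k * x)" for x
    using order_trans[OF C2[of x] mult_right_mono[of C2 C "exp (k * x)"]] by (simp add: C_def)
  have w1: "w \<noteq> 0" using w0 by (simp add: w_def)
  define D where "D = \<bar>2 * C\<^sup>2 / \<bar>w\<bar> * exp_kernel_mass k\<bar>"
  show ?thesis
  proof (rule resolvent_setI[OF subspace_schroedinger, where C = D])
    fix v :: l2
    obtain f f' where f: "ac_derivative f f'" "ac_derivative f' (\<lambda>x. W x * f x - l2_fun v x)" "square_integrable f"
      "(\<integral>x. (f x)\<^sup>2 \<partial>lborel) \<le> (2 * C\<^sup>2 / \<bar>w\<bar> * exp_kernel_mass k)\<^sup>2 * (\<integral>x. (l2_fun v x)\<^sup>2 \<partial>lborel)"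
      using green_solution[OF uv(1) uv'(1) w w1 k bu bu' l2_fun(1)[of v]] by blast
    define z where "z = Abs_l2 f"
    have z: "AE x in lborel. l2_fun z x = f x"
      unfolding z_def by (rule l2_fun_Abs[OF f(3)])
    have "AE x in lborel. l2_fun (v + E *\<^sub>R z) x = - (W x * f x - l2_fun v x) + V x * f x"
      using z l2_fun_add[of v "E *\<^sub>R z"] l2_fun_scaleR[of E z]
      by eventually_elim (simp add: W_def algebra_simps)
    then have "(z, v + E *\<^sub>R z) \<in> schroedinger V"
      by (rule schroedingerI[OF z f(1,2)])
    moreover have "norm z \<le> D * norm v"
    proof (rule power2_le_imp_le)
      have "(norm z)\<^sup>2 = (\<integral>x. (f x)\<^sup>2 \<partial>lborel)"
        using f(3) by (simp add: z_def power2_norm_eq_inner inner_Abs_l2 flip: power2_eq_square)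
      then show "(norm z)\<^sup>2 \<le> (D * norm v)\<^sup>2"
        using f(4) unfolding power_mult_distrib[of D "norm v"] unfolding D_def power2_abs norm_l2_power2[of v]
        by (simp only:)
    qed (simp add: D_def)
    ultimately show "\<exists>u. (u, v + E *\<^sub>R u) \<in> schroedinger V \<and> norm u \<le> D * norm v" by blast
  next
    fix z :: l2 assume "(z, E *\<^sub>R z) \<in> schroedinger V"
    then obtain f f' f'' where f: "AE x in lborel. l2_fun z x = f x" "ac_derivative f f'" "ac_derivative f' f''"
      "AE x in lborel. l2_fun (E *\<^sub>R z) x = - f'' x + V x * f x"
      unfolding schroedinger_def by blast
    have "AE x in lborel. f'' x = W x * f x"
      using f(1,4) l2_fun_scaleR[of E z] by eventually_elim (simp add: W_def algebra_simps)
    then have "ac_derivative f' (\<lambda>x. W x * f x)"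
      using f(3) by (rule ac_derivative_cong_AE[rotated 2])
        (intro locally_integrable_mult_continuous[OF W] ac_derivative_continuous[OF f(2)])
    then have sol: "schroedinger_solution W f f'"
      using f(2) by (simp add: schroedinger_solution_def)
    have sq: "square_integrable f"
    proof -
      have [measurable]: "f \<in> borel_measurable borel" by (rule schroedinger_solution_measurable[OF sol])
      have [measurable]: "l2_fun z \<in> borel_measurable borel" using l2_fun(1)[of z] by (simp add: square_integrable_def)
      have "integrable lborel (\<lambda>x. (l2_fun z x)\<^sup>2)" using l2_fun(1)[of z] by (simp add: square_integrable_def)
      moreover have "AE x in lborel. (l2_fun z x)\<^sup>2 = (f x)\<^sup>2" using f(1) by eventually_elim simp
      ultimately have "integrable lborel (\<lambda>x. (f x)\<^sup>2)"
        by (subst (asm) integrable_cong_AE) auto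
      then show ?thesis by (simp add: square_integrable_def)
    qed
    obtain \<alpha> \<beta> where fe: "\<And>x. f x = \<alpha> * u x + \<beta> * u' x"
      using schroedinger_solution_in_span[OF uv(1) uv'(1) sol, of s] w1 w by metis
    \<comment> \<open>Such combinations are again square integrable. Taking \<open>r\<close> as
      \<open>- \<rho>\<close> or as \<open>- (1 / \<rho>)\<close> removes one Floquet component and
      leaves a multiple of the other.\<close>
    have sqP: "square_integrable (\<lambda>x. f (x + P) + r * f x)" for r
      using square_integrable_add[OF square_integrable_shift[OF sq, of "-P"] square_integrable_cmult[OF sq, of r]]
      by simp
    have "AE x in lborel. (1 / \<rho> - \<rho>) * \<alpha> * u x = 0"
    proof (rule floquet_square_integrable_imp_zero[where P = P and \<rho> = "1 / \<rho>"])
      have "(\<lambda>x. f (x + P) + - \<rho> * f x) = (\<lambda>x. (1 / \<rho> - \<rho>) * \<alpha> * u x)"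
        by (simp add: fun_eq_iff fe uv(4) uv'(4) algebra_simps)
      then show "square_integrable (\<lambda>x. (1 / \<rho> - \<rho>) * \<alpha> * u x)" using sqP[of "- \<rho>"] by simp
    qed (use \<rho>2 in \<open>simp_all add: uv(4)\<close>)
    moreover have "AE x in lborel. (\<rho> - 1 / \<rho>) * \<beta> * u' x = 0"
    proof (rule floquet_square_integrable_imp_zero[where P = P and \<rho> = \<rho>])
      have "(\<lambda>x. f (x + P) + - (1 / \<rho>) * f x) = (\<lambda>x. (\<rho> - 1 / \<rho>) * \<beta> * u' x)"
        by (simp add: fun_eq_iff fe uv(4) uv'(4) algebra_simps)
      then show "square_integrable (\<lambda>x. (\<rho> - 1 / \<rho>) * \<beta> * u' x)" using sqP[of "- (1 / \<rho>)"] by simp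
    qed (use \<rho>(1) in \<open>simp_all add: uv'(4)\<close>)
    ultimately have "AE x in lborel. l2_fun z x = l2_fun 0 x"
      using f(1) l2_fun_zero
    proof eventually_elim
      case (elim x)
      then have "\<alpha> * u x = 0" "\<beta> * u' x = 0" using \<rho>1 by simp_all
      then show ?case using elim(3,4) by (metis fe add_0)
    qed
    then show "z = 0" by (simp add: l2_eq_iff)
  qed
qed

section \<open>Periodic potentials\<close>

lemma square_integrable_locally_integrable:
  assumes f: "square_integrable f"
  shows "locally_integrable f"
  unfolding locally_integrable_def set_integrable_def
proof (intro allI)
  fix s t :: real
  have [measurable]: "f \<in> borel_measurable borel" using f by (simp add: square_integrable_def)
  have 1: "integrable lborel (\<lambda>x. indicator {s..t} x + (f x)\<^sup>2)"
    using f locally_integrableD[OF locally_integrable_continuous[of "\<lambda>_. 1"], of s t]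
    by (intro Bochner_Integration.integrable_add) (simp_all add: square_integrable_def set_integrable_def)
  have le: "\<bar>f x\<bar> \<le> 1 + (f x)\<^sup>2" for x
  proof -
    have "0 \<le> (\<bar>f x\<bar> - 1)\<^sup>2" by simp
    then have "2 * \<bar>f x\<bar> \<le> 1 + (f x)\<^sup>2" by (simp add: power2_diff)
    then show ?thesis using abs_ge_zero[of "f x"] by linarith
  qed
  show "integrable lborel (\<lambda>x. indicator {s..t} x *\<^sub>R f x)"
  proof (rule Bochner_Integration.integrable_bound[OF 1])
    show "AE x in lborel. norm (indicator {s..t} x *\<^sub>R f x) \<le> norm (indicator {s..t} x + (f x)\<^sup>2)"
      using le by (auto split: split_indicator)
  qed measurable
qed

lemma locally_integrable_l2_fun: "locally_integrable (l2_fun u)"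
  by (rule square_integrable_locally_integrable[OF l2_fun(1)])

lemma potential_cell:
  assumes "0 < c" "of_int j * c \<le> x" "x < of_int (j + 1) * c"
  shows "potential c y x = l2_fun (y j) (x - of_int j * c)"
proof -
  have "\<lfloor>x / c\<rfloor> = j"
    by (rule floor_unique) (use assms in \<open>simp_all add: field_simps\<close>)
  then show ?thesis by (simp add: potential_def)
qed

lemma locally_integrable_potential:
  assumes c: "0 < c"
  shows "locally_integrable (potential c y)"
  unfolding locally_integrable_def
proof (intro allI)
  fix s t :: real
  let ?I = "\<lambda>j :: int. {of_int j * c..<of_int (j + 1) * c}"
  let ?J = "{\<lfloor>s / c\<rfloor>..\<lfloor>t / c\<rfloor>}"
  have 1: "set_integrable lborel (?I j) (potential c y)" for j
  proof -
    have "set_integrable lborel {of_int j * c..of_int (j + 1) * c} (\<lambda>x. l2_fun (y j) (x + - (of_int j * c)))"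
      by (rule locally_integrableD[OF locally_integrable_shift[OF locally_integrable_l2_fun]])
    then have "set_integrable lborel (?I j) (\<lambda>x. l2_fun (y j) (x + - (of_int j * c)))"
      by (rule set_integrable_subset) auto
    also have "set_integrable lborel (?I j) (\<lambda>x. l2_fun (y j) (x + - (of_int j * c))) =
        set_integrable lborel (?I j) (potential c y)"
      by (rule set_integrable_cong) (use potential_cell[OF c] in auto)
    finally show ?thesis .
  qed
  have U: "set_integrable lborel (\<Union>j\<in>?J. ?I j) (potential c y)"
    by (rule set_integrable_UN) (use 1 in auto)
  have "{s..t} \<subseteq> (\<Union>j\<in>?J. ?I j)"
  proof
    fix x assume "x \<in> {s..t}"
    then have "\<lfloor>x / c\<rfloor> \<in> ?J" using c by (auto intro!: floor_mono divide_right_mono)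
    moreover have "x \<in> ?I \<lfloor>x / c\<rfloor>"
      using floor_divide_lower[OF c, of x] floor_divide_upper[OF c, of x] by simp
    ultimately show "x \<in> (\<Union>j\<in>?J. ?I j)" by blast
  qed
  from set_integrable_subset[OF U _ this] show "set_integrable lborel {s..t} (potential c y)"
    by simp
qed

lemma potential_periodic:
  assumes c: "0 < c" and y: "\<And>j. y (j + n) = y j"
  shows "potential c y (x + of_int n * c) = potential c y x"
proof -
  have "(x + of_int n * c) / c = x / c + of_int n" using c by (simp add: field_simps)
  then have fl: "\<lfloor>(x + of_int n * c) / c\<rfloor> = \<lfloor>x / c\<rfloor> + n" by simp
  have "x + of_int n * c - of_int (\<lfloor>x / c\<rfloor> + n) * c = x - of_int \<lfloor>x / c\<rfloor> * c"
    by (simp add: algebra_simps)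
  then show ?thesis by (simp only: potential_def Let_def fl y)
qed

lemma periodic_ext_periodic: "periodic_ext xs (j + int (length xs)) = periodic_ext xs j"
proof -
  have "(j + int (length xs) - 1) mod int (length xs) = (j - 1 + int (length xs)) mod int (length xs)"
    by (simp add: algebra_simps)
  then show ?thesis by (simp add: periodic_ext_def)
qed

lemma periodic_ext_nth: "k < length xs \<Longrightarrow> periodic_ext xs (int k + 1) = xs ! k"
  by (simp add: periodic_ext_def)

text \<open>Since positions are traversed from left to right, the factors appear in reverse order.\<close>

primrec word_matrix :: "('a \<Rightarrow> real^2^2) \<Rightarrow> 'a list \<Rightarrow> real^2^2" where
  "word_matrix N [] = mat 1"
| "word_matrix N (x # xs) = word_matrix N xs ** N x"

lemma word_matrix_append: "word_matrix N (xs @ ys) = word_matrix N ys ** word_matrix N xs"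
  by (induction xs) (simp_all add: matrix_mul_assoc)

lemma det_word_matrix: "(\<And>x. det (N x) = 1) \<Longrightarrow> det (word_matrix N xs) = 1"
  by (induction xs) (simp_all add: det_mul)

text \<open>Letters are numbered from 1, so the first letter sits on the cell from \<open>c\<close>
  to \<open>2 * c\<close> and propagation starts at \<open>c\<close>, not at 0.\<close>

lemma transfers_word:
  assumes c: "0 < c" and N: "\<And>u. transfers (\<lambda>x. l2_fun u x - E) 0 c (N u)" and k: "k \<le> length xs"
  shows "transfers (\<lambda>x. potential c (periodic_ext xs) x - E) c (c + real k * c) (word_matrix N (take k xs))"
  using k
proof (induction k)
  case 0
  then show ?case by (simp add: transfers_def)
next
  case (Suc k)
  let ?W = "\<lambda>x. potential c (periodic_ext xs) x - E"
  let ?r = "c + real k * c"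
  have "locally_integrable (\<lambda>x. l2_fun (xs ! k) x - E)"
    by (intro locally_integrable_diff locally_integrable_l2_fun locally_integrable_continuous) auto
  moreover have "AE x in lborel. x \<in> {0..c} \<longrightarrow> ?W (x + ?r) = l2_fun (xs ! k) x - E"
  proof -
    \<comment> \<open>Cells are half-open while transfer intervals are closed; the right endpoint
      already belongs to the next letter.\<close>
    have "AE x in lborel. x \<noteq> c" by (rule AE_lborel_singleton)
    then show ?thesis
    proof eventually_elim
      case (elim x)
      have "potential c (periodic_ext xs) (x + ?r) = l2_fun (periodic_ext xs (int k + 1)) (x + ?r - of_int (int k + 1) * c)"
        if "0 \<le> x" "x \<le> c"
        by (rule potential_cell[OF c]) (use that elim in \<open>auto simp: algebra_simps\<close>)
      then show ?case using periodic_ext_nth[of k xs] Suc.prems by (auto simp: algebra_simps)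
    qed
  qed
  ultimately have "transfers (\<lambda>x. ?W (x + ?r)) 0 c (N (xs ! k))"
    using c by (intro transfers_cong_AE[OF N]) auto
  then have "transfers ?W (0 + ?r) (c + ?r) (N (xs ! k))" by (rule transfers_shift)
  moreover have "transfers ?W c ?r (word_matrix N (take k xs))" using Suc by simp
  ultimately have "transfers ?W c (c + ?r) (N (xs ! k) ** word_matrix N (take k xs))"
    by (intro transfers_comp) simp_all
  then show ?case
    using Suc.prems by (simp add: take_Suc_conv_app_nth word_matrix_append algebra_simps)
qed

lemma hyperbolic_word:
  assumes c: "0 < c" and N: "\<And>u. transfers (\<lambda>x. l2_fun u x - E) 0 c (N u)"
    and xs: "xs \<noteq> []" and tr: "2 < \<bar>trace (word_matrix N xs)\<bar>"
  shows "E \<notin> spec (word_operator c xs)"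
proof -
  have per: "potential c (periodic_ext xs) (x + real (length xs) * c) = potential c (periodic_ext xs) x" for x
    using potential_periodic[OF c, of "periodic_ext xs" "int (length xs)", OF periodic_ext_periodic] by simp
  have "E \<in> resolvent_set (schroedinger (potential c (periodic_ext xs)))"
  proof (rule hyperbolic_in_resolvent_set[OF locally_integrable_potential[OF c] _ per])
    show "0 < real (length xs) * c" using c xs by simp
    show "transfers (\<lambda>x. potential c (periodic_ext xs) x - E) c (c + real (length xs) * c) (word_matrix N xs)"
      using transfers_word[OF c N, of "length xs" xs] by simp
    show "2 < \<bar>trace (word_matrix N xs)\<bar>" by fact
  qed
  then show ?thesis by (simp add: spec_def word_operator_def)
qed

section \<open>Modifying a letter near its left end\<close>

lemma square_integrable_const_on: "square_integrable (\<lambda>x. if x \<in> {s..<t} then r else 0)"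
proof -
  have "(\<lambda>x. (if x \<in> {s..<t} then r else 0)\<^sup>2) = (\<lambda>x. r\<^sup>2 * indicator {s..<t} x)"
    by (auto simp: fun_eq_iff split: split_indicator)
  then show ?thesis
    by (cases "s \<le> t") (auto simp: square_integrable_def)
qed

definition two_steps :: "real \<Rightarrow> real \<Rightarrow> real \<Rightarrow> l2 \<Rightarrow> l2" where
  "two_steps h r s u = Abs_l2 (\<lambda>x. if x \<in> {0..<h} then r else if x \<in> {h..<2 * h} then s else l2_fun u x)"

lemma l2_fun_two_steps:
  assumes h: "0 < h"
  shows "AE x in lborel. l2_fun (two_steps h r s u) x =
    (if x \<in> {0..<h} then r else if x \<in> {h..<2 * h} then s else l2_fun u x)"
  unfolding two_steps_def
proof (rule l2_fun_Abs)
  have "(\<lambda>x. if x \<in> {0..<h} then r else if x \<in> {h..<2 * h} then s else l2_fun u x) =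
      (\<lambda>x. ((if x \<in> {0..<h} then r else 0) + (if x \<in> {h..<2 * h} then s else 0)) +
        (if x \<in> - {0..<2 * h} then l2_fun u x else 0))"
    using h by (auto simp: fun_eq_iff)
  then show "square_integrable (\<lambda>x. if x \<in> {0..<h} then r else if x \<in> {h..<2 * h} then s else l2_fun u x)"
    by (simp only:) (intro square_integrable_add square_integrable_const_on square_integrable_restrict l2_fun, simp)
qed

text \<open>Meant for \<open>r\<close> in \<open>{0, 1}\<close>; every nonzero value is treated as
  1.\<close>

definition step_matrix :: "real \<Rightarrow> real \<Rightarrow> real^2^2" where
  "step_matrix h r = (if r = 0 then free_step h else cosh_step h)"

lemma transfers_step:
  assumes "s \<le> t" "r \<in> {0, 1}" "AE x in lborel. x \<in> {s..t} \<longrightarrow> W x = r"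
  shows "transfers W s t (step_matrix (t - s) r)"
  using assms transfers_zero[of s t W] transfers_one[of s t W]
  by (auto simp: step_matrix_def free_step_def cosh_step_def)

text \<open>Beyond \<open>2 * h\<close> the modified letter agrees with \<open>u\<close>, so the
  same \<open>B\<close> serves for all four choices of heights. The earlier step stands further to
  the right in the product.\<close>

lemma transfers_two_steps:
  assumes h: "0 < h" "2 * h \<le> c" and rs: "r \<in> {0, 1}" "s \<in> {0, 1}"
    and B: "transfers (\<lambda>x. l2_fun u x - E) (2 * h) c B"
  shows "transfers (\<lambda>x. l2_fun (two_steps h (E + r) (E + s) u) x - E) 0 c
    (B ** (step_matrix h s ** step_matrix h r))"
proof -
  let ?W = "\<lambda>x. l2_fun (two_steps h (E + r) (E + s) u) x - E"
  note ae = l2_fun_two_steps[OF h(1), of "E + r" "E + s" u]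
  have ne: "AE x in lborel. x \<noteq> h" "AE x in lborel. x \<noteq> 2 * h" by (rule AE_lborel_singleton)+
  have "AE x in lborel. x \<in> {0..h} \<longrightarrow> ?W x = r"
    using ae ne(1) by eventually_elim auto
  from transfers_step[OF _ rs(1) this] have 1: "transfers ?W 0 h (step_matrix h r)" using h by simp
  have "AE x in lborel. x \<in> {h..2 * h} \<longrightarrow> ?W x = s"
    using ae ne(2) by eventually_elim auto
  from transfers_step[OF _ rs(2) this] have 2: "transfers ?W h (2 * h) (step_matrix h s)" using h by simp
  have l: "locally_integrable (\<lambda>x. l2_fun u x - E)"
    by (intro locally_integrable_diff locally_integrable_l2_fun locally_integrable_continuous) auto
  have "AE x in lborel. x \<in> {2 * h..c} \<longrightarrow> ?W x = l2_fun u x - E"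
    using ae by eventually_elim (use h in auto)
  then have "transfers ?W (2 * h) c B"
    by (rule transfers_cong_AE[OF B l h(2)])
  from transfers_comp[OF transfers_comp[OF 1 2] this] show ?thesis .
qed

text \<open>The squared difference is at most \<open>q\<close> on the modified interval, whatever
  the heights, so one \<open>h\<close> works for all of them; the integral of \<open>q\<close> over
  a shrinking interval tends to 0.\<close>

lemma two_steps_close:
  assumes e: "0 < e" and a: "0 < a" and R: "0 \<le> R"
  obtains h where "0 < h" "2 * h \<le> a"
    "\<And>r s. \<bar>r\<bar> \<le> R \<Longrightarrow> \<bar>s\<bar> \<le> R \<Longrightarrow> dist u (two_steps h r s u) < e"
proof -
  define q where "q x = 2 * (l2_fun u x)\<^sup>2 + 2 * R\<^sup>2" for x
  have "locally_integrable (\<lambda>x. (l2_fun u x)\<^sup>2)"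
    unfolding locally_integrable_def set_integrable_def
    by (intro allI integrable_mult_indicator) (use l2_fun(1)[of u] in \<open>simp_all add: square_integrable_def\<close>)
  then have q: "locally_integrable q"
    unfolding q_def
    by (intro locally_integrable_add locally_integrable_cmult) (auto intro: locally_integrable_continuous)
  note Q = ac_derivative_primitive[OF q]
  have "isCont (primitive q) 0"
    using ac_derivative_continuous[OF Q] by (simp add: continuous_on_eq_continuous_at)
  then obtain d where d: "0 < d" "\<And>x. dist x 0 < d \<Longrightarrow> dist (primitive q x) (primitive q 0) < e\<^sup>2"
    using e unfolding continuous_at_eps_delta by (metis zero_less_power)
  \<comment> \<open>Two steps of this length end at \<open>min a (d / 2)\<close>, which is at most
    \<open>a\<close> and strictly below \<open>d\<close>.\<close>
  define h where "h = min a (d / 2) / 2"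
  have h: "0 < h" "2 * h \<le> a" "2 * h < d" using a d(1) by (auto simp: h_def)
  have close: "dist u (two_steps h r s u) < e" if rs: "\<bar>r\<bar> \<le> R" "\<bar>s\<bar> \<le> R" for r s
  proof -
    let ?m = "two_steps h r s u"
    have sq: "(x - t)\<^sup>2 \<le> 2 * x\<^sup>2 + 2 * R\<^sup>2" if "\<bar>t\<bar> \<le> R" for x t :: real
    proof -
      have "t\<^sup>2 \<le> R\<^sup>2" using that R abs_le_square_iff[of t R] by simp
      moreover have "0 \<le> (x + t)\<^sup>2" by simp
      ultimately show ?thesis unfolding power2_diff power2_sum by linarith
    qed
    have "AE x in lborel. (l2_fun (u - ?m) x)\<^sup>2 \<le> indicator {0..2 * h} x *\<^sub>R q x"
      using l2_fun_diff[of u ?m] l2_fun_two_steps[OF h(1), of r s u]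
      by eventually_elim (use sq[OF rs(1)] sq[OF rs(2)] h in \<open>auto simp: q_def split: split_indicator\<close>)
    then have "(norm (u - ?m))\<^sup>2 \<le> (LBINT x:{0..2 * h}. q x)"
      unfolding norm_l2_power2 set_lebesgue_integral_def
      using locally_integrableD[OF q, of 0 "2 * h"] l2_fun(1)[of "u - ?m"]
      by (intro integral_mono_AE) (auto simp: square_integrable_def set_integrable_def)
    also have "\<dots> = primitive q (2 * h) - primitive q 0"
      by (rule ac_derivative_LBINT[OF Q]) (use h in simp)
    also have "\<dots> < e\<^sup>2"
      using d(2)[of "2 * h"] h by (simp add: dist_real_def)
    finally show ?thesis unfolding dist_norm by (rule power2_less_imp_less) (use e in simp)
  qed
  show thesis by (rule that[OF h(1,2) close])
qed

lemma two_steps_neq: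
  assumes h: "0 < h" and r: "r \<noteq> r'"
  shows "two_steps h r s u \<noteq> two_steps h r' s u"
proof
  assume eq: "two_steps h r s u = two_steps h r' s u"
  have "AE x in lborel. x \<notin> {0..<h}"
    using l2_fun_two_steps[OF h, of r s u] l2_fun_two_steps[OF h, of r' s u] unfolding eq
    by eventually_elim (use r in auto)
  then have "emeasure lborel {0..<h} = 0"
    by (subst (asm) AE_iff_measurable[of "{0..<h}"]) auto
  then show False using h by simp
qed

section \<open>Concatenations with a fixed right part\<close>

lemma l2_fun_concat:
  "AE x in lborel. l2_fun (l2_concat a b \<phi> \<psi>) x =
    (if x \<in> {0..<a} then l2_fun \<phi> x else if x \<in> {a..<a + b} then l2_fun \<psi> (x - a) else 0)"
proof -
  let ?h = "\<lambda>x. if x \<in> {0..<a} then l2_fun \<phi> x else if x \<in> {a..<a + b} then l2_fun \<psi> (x - a) else 0"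
  have "l2_concat a b (Abs_l2 (l2_fun \<phi>)) (Abs_l2 (l2_fun \<psi>)) = Abs_l2 ?h"
    by (rule l2_concat.abs_eq) (simp_all add: l2_fun)
  then have eq: "l2_concat a b \<phi> \<psi> = Abs_l2 ?h" by (simp add: l2_fun(2))
  have "?h = (\<lambda>x. (if x \<in> {0..<a} then l2_fun \<phi> x else 0) +
      (if x \<in> {a..<a + b} - {0..<a} then l2_fun \<psi> (x - a) else 0))"
    by auto
  then have "square_integrable ?h"
    by (simp only:) (intro square_integrable_add square_integrable_restrict square_integrable_shift l2_fun, simp_all)
  then show ?thesis unfolding eq by (rule l2_fun_Abs)
qed

text \<open>Membership constrains \<open>u\<close> only outside \<open>{0..<a}\<close>, where it is
  prescribed; inside, \<open>u\<close> itself supplies the free left part. Closedness and stability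
  under modification become almost-everywhere statements.\<close>

lemma concat_set_iff:
  assumes a: "0 < a"
  shows "u \<in> {l2_concat a b \<phi> \<psi> | \<phi>. \<phi> \<in> L2_Ico a} \<longleftrightarrow>
    (AE x in lborel. x \<notin> {0..<a} \<longrightarrow> l2_fun u x = (if x \<in> {a..<a + b} then l2_fun \<psi> (x - a) else 0))"
    (is "?L \<longleftrightarrow> ?R")
proof
  assume ?L
  then obtain \<phi> where u: "u = l2_concat a b \<phi> \<psi>" by blast
  show ?R unfolding u using l2_fun_concat[of a b \<phi> \<psi>] by eventually_elim auto
next
  assume R: ?R
  define \<phi> where "\<phi> = Abs_l2 (\<lambda>x. if x \<in> {0..<a} then l2_fun u x else 0)"
  have \<phi>: "AE x in lborel. l2_fun \<phi> x = (if x \<in> {0..<a} then l2_fun u x else 0)"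
    unfolding \<phi>_def by (intro l2_fun_Abs square_integrable_restrict l2_fun) simp
  have "\<phi> \<in> L2_Ico a"
    unfolding L2_Ico_def mem_Collect_eq using \<phi> by eventually_elim auto
  moreover have "u = l2_concat a b \<phi> \<psi>"
    unfolding l2_eq_iff using l2_fun_concat[of a b \<phi> \<psi>] \<phi> R by eventually_elim auto
  ultimately show ?L by blast
qed

lemma norm_l2_mono:
  assumes "AE x in lborel. \<bar>l2_fun u x\<bar> \<le> \<bar>l2_fun v x\<bar>"
  shows "norm u \<le> norm v"
proof (rule power2_le_imp_le)
  have "AE x in lborel. (l2_fun u x)\<^sup>2 \<le> (l2_fun v x)\<^sup>2"
    using assms by (simp only: abs_le_square_iff)
  then show "(norm u)\<^sup>2 \<le> (norm v)\<^sup>2"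
    unfolding norm_l2_power2 using l2_fun(1)[of u] l2_fun(1)[of v]
    by (intro integral_mono_AE) (auto simp: square_integrable_def)
qed simp

text \<open>Outside \<open>{0..<a}\<close> all members agree almost everywhere, so the deviation of
  the limit from them there is dominated by \<open>u - U n\<close> for every \<open>n\<close> and
  must have norm zero.\<close>

lemma closed_concat_set:
  assumes a: "0 < a"
  shows "closed {l2_concat a b \<phi> \<psi> | \<phi>. \<phi> \<in> L2_Ico a}" (is "closed ?Y")
  unfolding closed_sequential_limits
proof (intro allI impI)
  fix U u assume "(\<forall>n. U n \<in> ?Y) \<and> U \<longlonglongrightarrow> u"
  then have U: "\<And>n. U n \<in> ?Y" and lim: "U \<longlonglongrightarrow> u" by blast+
  let ?z = "\<lambda>x. if x \<in> {a..<a + b} then l2_fun \<psi> (x - a) else 0"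
  define w where "w = Abs_l2 (\<lambda>x. if x \<in> - {0..<a} then l2_fun (u - U 0) x else 0)"
  have w: "AE x in lborel. l2_fun w x = (if x \<in> - {0..<a} then l2_fun (u - U 0) x else 0)"
    unfolding w_def by (intro l2_fun_Abs square_integrable_restrict l2_fun) simp
  have "norm w \<le> norm (u - U n)" for n
  proof (rule norm_l2_mono)
    show "AE x in lborel. \<bar>l2_fun w x\<bar> \<le> \<bar>l2_fun (u - U n) x\<bar>"
      using w l2_fun_diff[of u "U 0"] l2_fun_diff[of u "U n"]
        U[of 0, unfolded concat_set_iff[OF a]] U[of n, unfolded concat_set_iff[OF a]]
      by eventually_elim auto
  qed
  moreover have "(\<lambda>n. norm (u - U n)) \<longlonglongrightarrow> norm (u - u)"
    by (intro tendsto_intros lim)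
  ultimately have "norm w \<le> norm (u - u)"
    by (intro LIMSEQ_le_const) auto
  then have "w = 0" by simp
  then have "AE x in lborel. l2_fun w x = 0" using l2_fun_zero by simp
  then show "u \<in> ?Y"
    unfolding concat_set_iff[OF a]
    using w l2_fun_diff[of u "U 0"] U[of 0, unfolded concat_set_iff[OF a]]
    by eventually_elim (auto split: if_splits)
qed

lemma two_steps_in_concat_set:
  assumes h: "0 < h" "2 * h \<le> a" and u: "u \<in> {l2_concat a b \<phi> \<psi> | \<phi>. \<phi> \<in> L2_Ico a}"
  shows "two_steps h r s u \<in> {l2_concat a b \<phi> \<psi> | \<phi>. \<phi> \<in> L2_Ico a}"
proof -
  have a: "0 < a" using h by linarith
  show ?thesis
    using u l2_fun_two_steps[OF h(1), of r s u] unfolding concat_set_iff[OF a]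
    by (rule eventually_elim2) (use h in auto)
qed

lemma perfect_concat_set:
  assumes a: "0 < a"
  shows "perfect {l2_concat a b \<phi> \<psi> | \<phi>. \<phi> \<in> L2_Ico a}" (is "perfect ?Y")
  unfolding perfect_def
proof (intro conjI ballI closed_concat_set[OF a])
  fix u assume u: "u \<in> ?Y"
  have "\<exists>v\<in>?Y. dist u v < e \<and> v \<noteq> u" if e: "0 < e" for e
  proof -
    obtain h where h: "0 < h" "2 * h \<le> a"
      and close: "\<And>r s. \<bar>r\<bar> \<le> 1 \<Longrightarrow> \<bar>s\<bar> \<le> 1 \<Longrightarrow> dist u (two_steps h r s u) < e"
      using two_steps_close[OF e a, of 1 u] by auto
    \<comment> \<open>Two distinct modifications cannot both equal \<open>u\<close>, so at least one
      of them is a different nearby point.\<close>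
    have "two_steps h 0 0 u \<noteq> two_steps h 1 0 u" using two_steps_neq[OF h(1), of 0 1] by simp
    then obtain r where "\<bar>r\<bar> \<le> 1" "two_steps h r 0 u \<noteq> u" by (metis abs_one abs_zero order_refl zero_le_one)
    then show ?thesis using close[of r 0] two_steps_in_concat_set[OF h u] by (intro bexI[of _ "two_steps h r 0 u"]) auto
  qed
  then show "\<not> u isolated_in ?Y" unfolding isolated_in_dist_Ex_iff by blast
qed

section \<open>Gap-richness\<close>

lemma nth_concat_blocks:
  assumes "\<And>p. p \<in> set ps \<Longrightarrow> length (f p) = n" "i < length (concat (map f ps))"
  shows "\<exists>p\<in>set ps. concat (map f ps) ! i = f p ! (i mod n) \<and> i mod n < n"
  using assms
proof (induction ps arbitrary: i)
  case (Cons p ps)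
  show ?case
  proof (cases "i < n")
    case True
    then show ?thesis using Cons.prems by (auto simp: nth_append)
  next
    case False
    then have "i - n < length (concat (map f ps))" using Cons.prems by auto
    then obtain p' where "p' \<in> set ps" "concat (map f ps) ! (i - n) = f p' ! ((i - n) mod n)" "(i - n) mod n < n"
      using Cons by auto
    moreover have "(i - n) mod n = i mod n" using False by (simp add: le_mod_geq)
    ultimately show ?thesis using False Cons.prems by (auto simp: nth_append)
  qed
qed simp

text \<open>The length of \<open>xs\<close> divides the length of the concatenation, so reducing a
  position modulo both lengths is the same as reducing it modulo the shorter one: every block is
  compared with \<open>xs\<close> in phase.\<close>

lemma word_dist_concat_le:
  fixes xs :: "'a::metric_space list"
  assumes ps: "ps \<noteq> []" and xs: "xs \<noteq> []" and len: "\<And>p. p \<in> set ps \<Longrightarrow> length (f p) = length xs"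
    and le: "\<And>p k. p \<in> set ps \<Longrightarrow> k < length xs \<Longrightarrow> dist (xs ! k) (f p ! k) \<le> e"
  shows "word_dist xs (concat (map f ps)) \<le> e"
  unfolding word_dist_def
proof (rule cSUP_least)
  fix j :: int
  let ?n = "length xs" and ?ys = "concat (map f ps)"
  have "map (length \<circ> f) ps = map (\<lambda>_. ?n) ps" using len by simp
  then have L: "length ?ys = length ps * ?n"
    by (simp only: length_concat map_map sum_list_triv of_nat_id)
  define i where "i = nat ((j - 1) mod int (length ?ys))"
  have pos: "0 < int (length ?ys)" using L ps xs by simp
  then have i: "i < length ?ys" unfolding i_def by (simp add: nat_less_iff)
  obtain p where p: "p \<in> set ps" "?ys ! i = f p ! (i mod ?n)" "i mod ?n < ?n"
    using nth_concat_blocks[of ps f, OF len i] by blast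
  have "int (i mod ?n) = (j - 1) mod int (length ?ys) mod int ?n"
    using pos by (simp add: i_def zmod_int)
  also have "\<dots> = (j - 1) mod int ?n"
    by (rule mod_mod_cancel) (simp add: L)
  finally have "nat ((j - 1) mod int ?n) = i mod ?n" by simp
  then show "dist (periodic_ext xs j) (periodic_ext ?ys j) \<le> e"
    using le[OF p(1,3)] p(2) by (simp add: periodic_ext_def i_def)
qed simp

lemma gap_rich_concat_set:
  assumes a: "0 < a" and b: "0 < b"
  shows "gap_rich (a + b) {l2_concat a b \<phi> \<psi> | \<phi>. \<phi> \<in> L2_Ico a}" (is "gap_rich ?c ?Y")
  unfolding gap_rich_def gap_rich_with_def
proof (intro exI[of _ "{}"] conjI ballI allI impI perfect_concat_set[OF a])
  show c: "0 < ?c" using a b by simp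
  show "?Y \<subseteq> L2_Ico ?c"
  proof
    fix u assume "u \<in> ?Y"
    then have "AE x in lborel. x \<notin> {0..<a} \<longrightarrow> l2_fun u x = (if x \<in> {a..<?c} then l2_fun \<psi> (x - a) else 0)"
      by (simp only: concat_set_iff[OF a])
    then have "AE x in lborel. x \<notin> {0..<?c} \<longrightarrow> l2_fun u x = 0"
      by eventually_elim (use a b in auto)
    then show "u \<in> L2_Ico ?c" by (simp add: L2_Ico_def)
  qed
  show "discrete ({} :: real set)" by (simp add: discrete_def)
  fix E :: real and xs \<epsilon> assume "xs \<in> words ?Y" and \<epsilon>: "0 < (\<epsilon> :: real)"
  then obtain u us where xs: "xs = u # us" and u: "u \<in> ?Y" and us: "us \<in> lists ?Y"
    by (cases xs) (auto simp: words_def)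
  \<comment> \<open>The heights used are \<open>E\<close> and \<open>E + 1\<close>, both bounded in
    modulus by \<open>\<bar>E\<bar> + 1\<close>; half of \<open>\<epsilon>\<close> leaves room for
    the supremum in \<open>word_dist\<close>.\<close>
  obtain h where h: "0 < h" "2 * h \<le> a"
    and close: "\<And>r s. \<bar>r\<bar> \<le> \<bar>E\<bar> + 1 \<Longrightarrow> \<bar>s\<bar> \<le> \<bar>E\<bar> + 1 \<Longrightarrow> dist u (two_steps h r s u) < \<epsilon> / 2"
    using two_steps_close[of "\<epsilon> / 2" a "\<bar>E\<bar> + 1" u] \<epsilon> a by auto
  have l: "locally_integrable (\<lambda>x. l2_fun v x - E)" for v
    by (intro locally_integrable_diff locally_integrable_l2_fun locally_integrable_continuous) auto
  have "\<forall>v. \<exists>M. transfers (\<lambda>x. l2_fun v x - E) 0 ?c M"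
    using transfers_exists[OF l] c by simp
  then obtain N where N: "\<And>v. transfers (\<lambda>x. l2_fun v x - E) 0 ?c (N v)" by metis
  have detN: "det (N v) = 1" for v
    using transfers_det[OF N l] c by simp
  have hc: "2 * h \<le> ?c" using h b by simp
  obtain B where B: "transfers (\<lambda>x. l2_fun u x - E) (2 * h) ?c B"
    using transfers_exists[OF l hc] by blast
  have detB: "det B = 1" by (rule transfers_det[OF B l hc])
  define S where "S = {0, 1 :: real} \<times> {0, 1 :: real}"
  define block where "block = (\<lambda>(r, s). two_steps h (E + r) (E + s) u # us)"
  define G where "G = {word_matrix N (concat (map block ps)) | ps. ps \<noteq> [] \<and> set ps \<subseteq> S}"
  have "\<exists>A\<in>G. 2 < \<bar>trace A\<bar>"
  proof (rule semigroup_contains_hyperbolic[OF h(1), where B = "word_matrix N us ** B"])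
    fix A A' assume "A \<in> G" "A' \<in> G"
    then obtain ps qs where "ps \<noteq> []" "set ps \<subseteq> S" "A = word_matrix N (concat (map block ps))"
      "set qs \<subseteq> S" "A' = word_matrix N (concat (map block qs))"
      unfolding G_def by blast
    \<comment> \<open>Matrix products run against the order of the letters, hence
      \<open>qs @ ps\<close>.\<close>
    then show "A ** A' \<in> G"
      unfolding G_def by (auto intro!: exI[of _ "qs @ ps"] simp: word_matrix_append)
  next
    show "det A = 1" if "A \<in> G" for A using that det_word_matrix[OF detN] unfolding G_def by auto
    show "det (word_matrix N us ** B) = 1" by (simp add: det_mul det_word_matrix[OF detN] detB)
  next
    fix K K' assume "K \<in> {free_step h, cosh_step h}" "K' \<in> {free_step h, cosh_step h}"
    \<comment> \<open>The left factor \<open>K\<close> belongs to the second step, so it determines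
      \<open>s\<close>, and \<open>K'\<close> determines \<open>r\<close>.\<close>
    then obtain r s where K: "r \<in> {0, 1}" "s \<in> {0, 1}" "K = step_matrix h s" "K' = step_matrix h r"
      unfolding step_matrix_def by (metis insert_iff singletonD zero_neq_one)
    have "N (two_steps h (E + r) (E + s) u) = B ** (K ** K')"
      using transfers_unique[OF N transfers_two_steps[OF h(1) hc K(1,2) B] l] K(3,4) by simp
    then have "word_matrix N us ** B ** (K ** K') = word_matrix N (concat (map block [(r, s)]))"
      by (simp add: block_def matrix_mul_assoc)
    moreover have "set [(r, s)] \<subseteq> S" using K(1,2) by (auto simp: S_def)
    ultimately show "word_matrix N us ** B ** (K ** K') \<in> G" unfolding G_def by blast
  qed
  then obtain ps where ps: "ps \<noteq> []" "set ps \<subseteq> S"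
    and tr: "2 < \<bar>trace (word_matrix N (concat (map block ps)))\<bar>"
    unfolding G_def by blast
  let ?ys = "concat (map block ps)"
  have ne: "?ys \<noteq> []" using ps(1) by (cases ps) (auto simp: block_def split: prod.splits)
  have letter: "two_steps h (E + r) (E + s) u \<in> ?Y" for r s
    by (rule two_steps_in_concat_set[OF h u])
  show "\<exists>ys\<in>words ?Y. word_dist xs ys < \<epsilon> \<and> E \<notin> spec (word_operator ?c ys)"
  proof (intro bexI conjI)
    show "E \<notin> spec (word_operator ?c ?ys)"
      by (rule hyperbolic_word[OF c N ne tr])
    have "word_dist xs ?ys \<le> \<epsilon> / 2"
    proof (rule word_dist_concat_le[OF ps(1)])
      fix p k assume p: "p \<in> set ps" and k: "k < length xs"
      then obtain r s where rs: "p = (r, s)" "r \<in> {0, 1}" "s \<in> {0, 1}"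
        using ps(2) unfolding S_def by blast
      have "\<bar>E + r\<bar> \<le> \<bar>E\<bar> + 1" "\<bar>E + s\<bar> \<le> \<bar>E\<bar> + 1" using rs by auto
      from close[OF this] show "dist (xs ! k) (block p ! k) \<le> \<epsilon> / 2"
        using \<epsilon> by (cases k) (simp_all add: xs rs block_def)
    qed (simp_all add: xs block_def split: prod.splits)
    then show "word_dist xs ?ys < \<epsilon>" using \<epsilon> by simp
    have "set ?ys \<subseteq> ?Y"
    proof
      fix v assume "v \<in> set ?ys"
      then obtain p where "v \<in> set (block p)" by auto
      then show "v \<in> ?Y" using letter us unfolding block_def by (cases p) auto
    qed
    then show "?ys \<in> words ?Y" using ne by (simp add: words_def lists_eq_set)
  qed
qed

theorem theorem2p17:
  fixes a b :: real and \<psi> :: l2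
  assumes "a > 0" and "b > 0" and "\<psi> \<in> L2_Ico b"
  shows "gap_rich (a + b) {l2_concat a b \<phi> \<psi> | \<phi>. \<phi> \<in> L2_Ico a}"
  using assms(1,2) by (rule gap_rich_concat_set)

end
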